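(* Choose stepsizes $\gamma,\delta>0$ such that $\gamma<2\beta$ and the Standing Assumption (stated in the context) is satisfied. Let $(\mathbf{z}^*,\mathbf{s}^* )$ be any fixed point of the operator $\mathbf{T}_{\mathrm{PD3O}}$ defined in the context, and let $(\mathbf{z}^k,\mathbf{s}^k)_{k\ge 0}$ be the sequence generated from a starting point $(\mathbf{z}^0,\mathbf{s}^0)\in\mathcal{X}\times\mathcal{S}$ by the PD3O iteration $(\mathbf{z}^{k+1},\mathbf{s}^{k+1})=\mathbf{T}_{\mathrm{PD3O}}(\mathbf{z}^k,\mathbf{s}^k)$. Then: 1) The sequence $(\|(\mathbf{z}^k,\mathbf{s}^k)-(\mathbf{z}^*,\mathbf{s}^* )\|_{\mathbf{I},\mathbf{M}})_{k\ge 0}$ is monotonically nonincreasing. 2) The sequence $(\|\mathbf{T}_{\mathrm{PD3O}}(\mathbf{z}^k,\mathbf{s}^k)-(\mathbf{z}^k,\mathbf{s}^k)\|_{\mathbf{I},\mathbf{M}})_{k\ge 0}$ is monotonically nonincreasing and converges to $0$. 3) The following convergence rate holds: $$\|\mathbf{T}_{\mathrm{PD3O}}(\mathbf{z}^k,\mathbf{s}^k)-(\mathbf{z}^k,\mathbf{s}^k)\|_{\mathbf{I},\mathbf{M}}^2\le \frac{2\beta}{2\beta-\gamma}\,\frac{\|(\mathbf{z}^0,\mathbf{s}^0)-(\mathbf{z}^*,\mathbf{s}^* )\|_{\mathbf{I},\mathbf{M}}^2}{k+1}$$ and $$\|\mathbf{T}_{\mathrm{PD3O}}(\mathbf{z}^k,\mathbf{s}^k)-(\mathbf{z}^k,\mathbf{s}^k)\|_{\mathbf{I},\mathbf{M}}^2=o\left(\frac{1}{k+1}\right).$$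 4) $(\mathbf{z}^k,\mathbf{s}^k)$ weakly converges to a fixed point of $\mathbf{T}_{\mathrm{PD3O}}$.
   Context: $\mathcal{X}$ and $\mathcal{S}$ are real Hilbert spaces, $\mathbf{A}:\mathcal{X}\to\mathcal{S}$ is a bounded linear operator with adjoint $\mathbf{A}^\top$, $\mathbf{I}$ is the identity operator, and $\gamma,\delta>0$ are the primal and dual stepsizes. $f:\mathcal{X}\to\mathbb{R}$, $g:\mathcal{X}\to(-\infty,+\infty]$, $h,l:\mathcal{S}\to(-\infty,+\infty]$ are proper lower semi-continuous convex functions; $h^*,l^*$ denote convex conjugates; $f$ and $l^*:\mathcal{S}\to\mathbb{R}$ are differentiable with Lipschitz continuous gradients. For $\lambda>0$ and a proper lower semi-continuous convex function $\phi$, $\mathbf{prox}_{\lambda\phi}(\tilde{\mathbf{x}})=\arg\min_{\mathbf{x}}\lambda\phi(\mathbf{x})+\frac12\|\mathbf{x}-\tilde{\mathbf{x}}\|^2$. The operator $\mathbf{T}_{\mathrm{PD3O}}:\mathcal{X}\times\mathcal{S}\to\mathcal{X}\times\mathcal{S}$, $(\mathbf{z},\mathbf{s})\mapsto(\mathbf{z}^+,\mathbf{s}^+)$, is defined by $$\mathbf{x}=\mathbf{prox}_{\gamma g}(\mathbf{z}),$$ $$\mathbf{s}^+=\mathbf{prox}_{\delta h^*}\big((\mathbf{I}-\gamma\delta\mathbf{A}\mathbf{A}^\top)\mathbf{s}-\delta\nabla l^*(\mathbf{s})+\delta\mathbf{A}(2\mathbf{x}-\mathbf{z}-\gamma\nabla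 f(\mathbf{x}))\big),$$ $$\mathbf{z}^+=\mathbf{x}-\gamma\nabla f(\mathbf{x})-\gamma\mathbf{A}^\top\mathbf{s}^+.$$ Let $\mathbf{M}=\frac{\gamma}{\delta}(\mathbf{I}-\gamma\delta\mathbf{A}\mathbf{A}^\top)$ and $\langle\mathbf{s}_1,\mathbf{s}_2\rangle_{\mathbf{M}}=\langle\mathbf{s}_1,\mathbf{M}\mathbf{s}_2\rangle$. When $\mathbf{M}$ is positive semidefinite, $\|\mathbf{s}\|_{\mathbf{M}}=\sqrt{\langle\mathbf{s},\mathbf{s}\rangle_{\mathbf{M}}}$ and $\|(\mathbf{z},\mathbf{s})\|_{\mathbf{I},\mathbf{M}}=\sqrt{\|\mathbf{z}\|^2+\|\mathbf{s}\|_{\mathbf{M}}^2}$. When $\mathbf{M}$ is positive definite, $\|\mathbf{s}\|_{\mathbf{M}^{-1}}=\sqrt{\langle\mathbf{s},\mathbf{M}^{-1}\mathbf{s}\rangle}$. Standing Assumption: $f,g,h,l$ are proper lower semi-continuous convex and there is $\beta>0$ such that for all $\mathbf{x}_1,\mathbf{x}_2\in\mathcal{X}$ and $\mathbf{s}_1,\mathbf{s}_2\in\mathcal{S}$, $$\langle\mathbf{x}_1-\mathbf{x}_2,\nabla f(\mathbf{x}_1)-\nabla f(\mathbf{x}_2)\rangle\ge\beta\|\nabla f(\mathbf{x}_1)-\nabla f(\mathbf{x}_2)\|^2,$$ $$\langle\mathbf{s}_1-\mathbf{s}_2,\nabla l^*(\mathbf{s}_1)-\nabla l^*(\mathbf{s}_2)\rangle\ge\beta\|\nabla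 l^*(\mathbf{s}_1)-\nabla l^*(\mathbf{s}_2)\|_{\mathbf{M}^{-1}}^2.$$ $\mathbf{M}$ is assumed positive definite if $\nabla l^*$ is not constant. If $\nabla l^*$ is constant, the second inequality is regarded as satisfied for any $\beta>0$ and any positive semidefinite $\mathbf{M}$, and $\mathbf{M}$ is only assumed positive semidefinite. *)

theory Defs
  imports "HOL-Analysis.Analysis" "HOL-Library.Landau_Symbols"
begin

text \<open>
  A function into \<open>(-\<infinity>, +\<infinity>]\<close> is an \<^typ>\<open>ereal\<close>-valued function that never takes the value
  \<open>-\<infinity>\<close>; this is part of \<open>proper_fun\<close>. Hence the sums in \<open>convex_fun\<close> and \<open>prox\<close> never
  meet \<open>\<infinity> - \<infinity>\<close>. In \<open>convex_fun\<close> only weights strictly between 0 and 1 occur, so the convention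
  \<open>0 * \<infinity> = 0\<close> plays no role.
\<close>

definition proper_fun :: "('a \<Rightarrow> ereal) \<Rightarrow> bool" where
  "proper_fun \<phi> \<longleftrightarrow> (\<forall>x. \<phi> x \<noteq> -\<infinity>) \<and> (\<exists>x. \<phi> x \<noteq> \<infinity>)"

definition convex_fun :: "('a::real_vector \<Rightarrow> ereal) \<Rightarrow> bool" where
  "convex_fun \<phi> \<longleftrightarrow> (\<forall>x y. \<forall>t::real. 0 < t \<and> t < 1 \<longrightarrow>
     \<phi> ((1 - t) *\<^sub>R x + t *\<^sub>R y) \<le> ereal (1 - t) * \<phi> x + ereal t * \<phi> y)"

definition lsc_fun :: "('a::topological_space \<Rightarrow> ereal) \<Rightarrow> bool" where
  "lsc_fun \<phi> \<longleftrightarrow> (\<forall>x. \<forall>c < \<phi> x. \<forall>\<^sub>F y in nhds x. c < \<phi> y)"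

definition proper_lsc_convex :: "('a::real_normed_vector \<Rightarrow> ereal) \<Rightarrow> bool" where
  "proper_lsc_convex \<phi> \<longleftrightarrow> proper_fun \<phi> \<and> lsc_fun \<phi> \<and> convex_fun \<phi>"

definition conjugate :: "('a::real_inner \<Rightarrow> ereal) \<Rightarrow> 'a \<Rightarrow> ereal" where
  "conjugate \<phi> s = (SUP x. ereal (s \<bullet> x) - \<phi> x)"

definition prox :: "real \<Rightarrow> ('a::real_normed_vector \<Rightarrow> ereal) \<Rightarrow> 'a \<Rightarrow> 'a" where
  "prox c \<phi> z = (ARG_MIN (\<lambda>x. ereal c * \<phi> x + ereal (1 / 2 * (norm (x - z))\<^sup>2)) x. True)"

definition grad :: "('a::real_inner \<Rightarrow> real) \<Rightarrow> 'a \<Rightarrow> 'a" where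
  "grad \<phi> x = (THE d. GDERIV \<phi> x :> d)"

text \<open>The convex conjugate as a real-valued function; meaningful when the conjugate is finite everywhere.\<close>

definition real_conjugate :: "('a::real_inner \<Rightarrow> ereal) \<Rightarrow> 'a \<Rightarrow> real" where
  "real_conjugate \<phi> s = real_of_ereal (conjugate \<phi> s)"

definition T_PD3O ::
  "real \<Rightarrow> real \<Rightarrow> ('x::real_inner \<Rightarrow> 's::real_inner) \<Rightarrow>
   ('x \<Rightarrow> real) \<Rightarrow> ('x \<Rightarrow> ereal) \<Rightarrow> ('s \<Rightarrow> ereal) \<Rightarrow> ('s \<Rightarrow> ereal) \<Rightarrow> 'x \<times> 's \<Rightarrow> 'x \<times> 's" where
  "T_PD3O \<gamma> \<delta> A f g h l = (\<lambda>(z, s).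
     let x = prox \<gamma> g z;
         s' = prox \<delta> (conjugate h)
                (s - (\<gamma> * \<delta>) *\<^sub>R A (adjoint A s) - \<delta> *\<^sub>R grad (real_conjugate l) s
                 + \<delta> *\<^sub>R A (2 *\<^sub>R x - z - \<gamma> *\<^sub>R grad f x));
         z' = x - \<gamma> *\<^sub>R grad f x - \<gamma> *\<^sub>R adjoint A s'
     in (z', s'))"

definition M_op :: "real \<Rightarrow> real \<Rightarrow> ('x::real_inner \<Rightarrow> 's::real_inner) \<Rightarrow> 's \<Rightarrow> 's" where
  "M_op \<gamma> \<delta> A s = (\<gamma> / \<delta>) *\<^sub>R (s - (\<gamma> * \<delta>) *\<^sub>R A (adjoint A s))"

definition pos_semidef :: "('s::real_inner \<Rightarrow> 's) \<Rightarrow> bool" where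
  "pos_semidef M \<longleftrightarrow> (\<forall>s. 0 \<le> s \<bullet> M s)"

definition pos_def :: "('s::real_inner \<Rightarrow> 's) \<Rightarrow> bool" where
  "pos_def M \<longleftrightarrow> (\<forall>s. s \<noteq> 0 \<longrightarrow> 0 < s \<bullet> M s)"

definition norm_M :: "('s::real_inner \<Rightarrow> 's) \<Rightarrow> 's \<Rightarrow> real" where
  "norm_M M s = sqrt (s \<bullet> M s)"

definition norm_IM :: "('s::real_inner \<Rightarrow> 's) \<Rightarrow> 'x::real_inner \<times> 's \<Rightarrow> real" where
  "norm_IM M w = sqrt ((norm (fst w))\<^sup>2 + (norm_M M (snd w))\<^sup>2)"

definition norm_Minv :: "('s::real_inner \<Rightarrow> 's) \<Rightarrow> 's \<Rightarrow> real" where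
  "norm_Minv M s = sqrt (s \<bullet> inv M s)"

definition cocoercive :: "real \<Rightarrow> ('a::real_inner \<Rightarrow> 'a) \<Rightarrow> bool" where
  "cocoercive \<beta> G \<longleftrightarrow> (\<forall>u v. (u - v) \<bullet> (G u - G v) \<ge> \<beta> * (norm (G u - G v))\<^sup>2)"

text \<open>
  A linear \<open>M\<close> that is positive definite in the sense of \<open>pos_def\<close> is injective, so \<open>inv M\<close> is its
  inverse on \<open>range M\<close>. In infinite dimensions \<open>M\<close> need not be surjective; the range condition below
  says that \<open>norm_Minv\<close> is only applied where the inverse is defined. It holds automatically
  if \<open>M\<close> is onto, in particular if \<open>M\<close> is bounded, self-adjoint and bounded below by a positive
  multiple of the identity.
\<close>

definition cocoercive_Minv :: "real \<Rightarrow> ('s::real_inner \<Rightarrow> 's) \<Rightarrow> ('s \<Rightarrow> 's) \<Rightarrow> bool" where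
  "cocoercive_Minv \<beta> M G \<longleftrightarrow> (\<forall>u v. G u - G v \<in> range M \<and>
     (u - v) \<bullet> (G u - G v) \<ge> \<beta> * (norm_Minv M (G u - G v))\<^sup>2)"

definition weakly_converges :: "(nat \<Rightarrow> 'a::real_inner) \<Rightarrow> 'a \<Rightarrow> bool" where
  "weakly_converges X a \<longleftrightarrow> (\<forall>y. (\<lambda>k. X k \<bullet> y) \<longlonglongrightarrow> a \<bullet> y)"

end

theory Submission
  imports Defs
begin

text \<open>
  Write \<open>M = (\<gamma> / \<delta>) (I - \<gamma> \<delta> A A\<^sup>*)\<close> and measure pairs in the seminorm \<^term>\<open>norm_IM M\<close>. The PD3O operator
  evaluates two proximal maps, which are firmly nonexpansive (\<open>prox_firmly_nonexpansive\<close>), and two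
  cocoercive gradients. Adding the two monotonicity inequalities of the proximal maps at a pair of
  points, the terms involving \<open>A\<close> cancel or are absorbed into \<open>M\<close>, because the two steps are coupled
  through \<open>A\<close> and its adjoint (\<open>monotone_inclusions_inequality\<close>); the gradient terms are absorbed by
  cocoercivity. The outcome is that the operator is averaged in the seminorm (\<open>T_averaged\<close>):
  \<open>\<parallel>T w - T w'\<parallel>\<^sup>2 + (2 \<beta> - \<gamma>) / (2 \<beta>) \<parallel>(w - w') - (T w - T w')\<parallel>\<^sup>2 \<le> \<parallel>w - w'\<parallel>\<^sup>2\<close>.
  Taking a fixed point for \<open>w'\<close> gives the monotone distances, taking two consecutive iterates gives
  the monotone residuals, and a decreasing sequence whose partial sums are bounded obeys both rates
  (\<open>decseq_summable_rate\<close>).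

  Weak convergence needs more care than the usual argument for averaged maps, because \<open>M\<close> may be
  degenerate or have no positive lower bound, so that the seminorm does not control the dual variable.
  Two observations repair this. First, \<open>T\<close> is Lipschitz from the seminorm to the norm
  (\<open>T_lipschitz_seminorm\<close>): the iterates are bounded in norm, their increments tend to 0 in norm, and
  fixed points at seminorm distance 0 coincide. Second, when only half of the cocoercivity
  is spent on the cross terms, the other half shows that both gradients converge in norm along the
  iteration (\<open>gradient_gap\<close>, \<open>gradients_tendsto\<close>). A weak limit can therefore be inserted into the two monotone
  inclusions directly, and Minty's trick identifies it as a fixed point, including its component in
  the kernel of \<open>M\<close> (\<open>weak_cluster_point_is_fixed\<close>). Opial's argument shows that there is only one weak
  cluster point (\<open>weak_cluster_point_unique\<close>).

  The Hilbert space background, namely existence of proximal points, properness of conjugates, the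
  Riesz representation and weak compactness of bounded sets, all grows out of one fact: a proper lower
  semicontinuous convex function plus a squared distance has a minimizer
  (\<open>prox_objective_has_minimizer\<close>).
\<close>

section \<open>Proximal maps in Hilbert spaces\<close>

text \<open>
  Lower semicontinuity bounds \<open>\<phi>\<close> from below near a point \<open>x0\<close> of its domain. On a segment from \<open>x0\<close> to
  \<open>x\<close>, convexity turns a very negative value at \<open>x\<close> into a drop below that local bound, so \<open>\<phi>\<close>
  decreases at most linearly. Such a minorant suffices to bound proximal objectives from below.
\<close>

lemma proper_lsc_convex_minorant:
  fixes \<phi> :: "'a::real_normed_vector \<Rightarrow> ereal"
  assumes "proper_lsc_convex \<phi>"
  shows "\<exists>a b. 0 \<le> b \<and> (\<forall>x. ereal (a - b * norm (x - z)) \<le> \<phi> x)"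
proof -
  have proper: "\<And>x. \<phi> x \<noteq> -\<infinity>" and lsc: "lsc_fun \<phi>" and conv: "convex_fun \<phi>"
    using assms by (auto simp: proper_lsc_convex_def proper_fun_def)
  obtain x0 where "\<phi> x0 \<noteq> \<infinity>"
    using assms by (auto simp: proper_lsc_convex_def proper_fun_def)
  then obtain v where v: "\<phi> x0 = ereal v"
    using proper[of x0] by (cases "\<phi> x0") auto
  have "\<forall>\<^sub>F y in nhds x0. ereal (v - 1) < \<phi> y"
    using lsc v by (simp add: lsc_fun_def)
  then obtain d where d: "0 < d" and near: "\<And>y. dist y x0 < d \<Longrightarrow> ereal (v - 1) < \<phi> y"
    by (auto simp: eventually_nhds_metric)
  have bound: "ereal (v - 1 - 2 / d * norm (x - x0)) \<le> \<phi> x" for x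
  proof (cases "norm (x - x0) < d")
    case True
    have "ereal (v - 1 - 2 / d * norm (x - x0)) \<le> ereal (v - 1)"
      using d by simp
    also have "\<dots> \<le> \<phi> x"
      using near[of x] True by (simp add: dist_norm order_less_imp_le)
    finally show ?thesis .
  next
    case False
    show ?thesis
    proof (cases "\<phi> x")
      case (real u)
      define n where "n = norm (x - x0)"
      have n: "0 < n" "d \<le> n" using False d by (auto simp: n_def)
      \<comment> \<open>this \<open>t\<close> places \<open>y\<close> on the segment at distance \<open>d / 2\<close> from \<open>x0\<close>, inside the ball of \<open>near\<close>\<close>
      define t where "t = d / (2 * n)"
      have t: "0 < t" "t < 1" using d n by (auto simp: t_def)
      define y where "y = (1 - t) *\<^sub>R x0 + t *\<^sub>R x"
      have "y - x0 = t *\<^sub>R (x - x0)" by (simp add: y_def algebra_simps)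
      then have "dist y x0 = t * n" using t by (simp add: dist_norm n_def)
      then have "dist y x0 < d" using d n by (simp add: t_def)
      then have "ereal (v - 1) < \<phi> y" by (rule near)
      also have "\<phi> y \<le> ereal (1 - t) * \<phi> x0 + ereal t * \<phi> x"
        using conv t unfolding convex_fun_def y_def by blast
      also have "\<dots> = ereal ((1 - t) * v + t * u)" by (simp add: v real)
      finally have "v - 1 < (1 - t) * v + t * u" by simp
      then have "- 1 < t * (u - v)" by (simp add: algebra_simps)
      then have "- (1 / t) < u - v" using t by (simp add: field_simps)
      then show ?thesis using real d n by (simp add: t_def n_def[symmetric] field_simps)
    qed (use proper in auto)
  qed
  show ?thesis
  proof (intro exI conjI allI)
    show "0 \<le> 2 / d" using d by simp
    fix x
    have "norm (x - x0) \<le> norm (x - z) + norm (z - x0)"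
      using norm_triangle_ineq[of "x - z" "z - x0"] by simp
    then have "2 / d * norm (x - x0) \<le> 2 / d * (norm (x - z) + norm (z - x0))"
      using d by (intro mult_left_mono) auto
    then have "v - 1 - 2 / d * norm (z - x0) - 2 / d * norm (x - z) \<le> v - 1 - 2 / d * norm (x - x0)"
      by (simp add: distrib_left)
    then show "ereal (v - 1 - 2 / d * norm (z - x0) - 2 / d * norm (x - z)) \<le> \<phi> x"
      using bound[of x] order_trans ereal_less_eq(3) by blast
  qed
qed

lemma parallelogram_midpoint:
  fixes x y z :: "'a::real_inner"
  shows "(norm ((1/2) *\<^sub>R x + (1/2) *\<^sub>R y - z))\<^sup>2
    = (norm (x - z))\<^sup>2 / 2 + (norm (y - z))\<^sup>2 / 2 - (norm (x - y))\<^sup>2 / 4"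
  by (simp add: power2_norm_eq_inner inner_commute inner_add_left inner_add_right
      inner_diff_left inner_diff_right field_simps)

text \<open>
  The objective is strongly convex: by the midpoint identity, two points whose values are close to
  the infimum are close to each other. Hence every minimizing sequence is Cauchy, and lower
  semicontinuity makes its limit a minimizer.
\<close>

lemma prox_objective_has_minimizer:
  fixes \<phi> :: "'a::{real_inner,complete_space} \<Rightarrow> ereal"
  assumes \<phi>: "proper_lsc_convex \<phi>" and c: "0 < c"
  shows "\<exists>p. \<forall>x. ereal c * \<phi> p + ereal (1 / 2 * (norm (p - z))\<^sup>2)
                 \<le> ereal c * \<phi> x + ereal (1 / 2 * (norm (x - z))\<^sup>2)"
proof -
  have proper: "\<And>x. \<phi> x \<noteq> -\<infinity>" and lsc: "lsc_fun \<phi>" and conv: "convex_fun \<phi>"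
    using \<phi> by (auto simp: proper_lsc_convex_def proper_fun_def)
  define D where "D = {x. \<phi> x \<noteq> \<infinity>}"
  define r where "r x = real_of_ereal (\<phi> x)" for x
  define J where "J x = c * r x + 1 / 2 * (norm (x - z))\<^sup>2" for x
  have r: "\<phi> x = ereal (r x)" if "x \<in> D" for x
    using that proper[of x] by (cases "\<phi> x") (auto simp: D_def r_def)
  have "D \<noteq> {}"
    using \<phi> by (auto simp: D_def proper_lsc_convex_def proper_fun_def)
  obtain a b where b: "0 \<le> b" and ab: "\<And>x. ereal (a - b * norm (x - z)) \<le> \<phi> x"
    using proper_lsc_convex_minorant[OF \<phi>, of z] by blast
  have J_ge: "c * a - (c * b)\<^sup>2 / 2 \<le> J x" if "x \<in> D" for x
  proof -
    have "a - b * norm (x - z) \<le> r x" using ab[of x] r[OF that] by simp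
    then have "c * (a - b * norm (x - z)) \<le> c * r x" using c by simp
    moreover have "0 \<le> (norm (x - z) - c * b)\<^sup>2" by simp
    ultimately show ?thesis unfolding J_def by (simp add: power2_eq_square algebra_simps)
  qed
  then have bdd: "bdd_below (J ` D)" by (intro bdd_belowI) auto
  define m where "m = Inf (J ` D)"
  have m_le: "m \<le> J x" if "x \<in> D" for x
    unfolding m_def using bdd that by (intro cInf_lower) auto
  have "\<exists>x\<in>D. J x < m + 1 / real (Suc n)" for n
  proof -
    have "Inf (J ` D) < m + 1 / real (Suc n)" by (simp add: m_def)
    then show ?thesis using \<open>D \<noteq> {}\<close> bdd by (subst (asm) cInf_less_iff) auto
  qed
  then have "\<forall>n. \<exists>x. x \<in> D \<and> J x < m + 1 / real (Suc n)" by blast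
  then obtain X where X: "\<forall>n. X n \<in> D \<and> J (X n) < m + 1 / real (Suc n)"
    unfolding choice_iff by (elim exE)
  have XD: "X n \<in> D" and XJ: "J (X n) < m + 1 / real (Suc n)" for n
    using X by auto
  have gap: "(norm (x - y))\<^sup>2 \<le> 4 * (J x - m) + 4 * (J y - m)" if "x \<in> D" "y \<in> D" for x y
  proof -
    define q where "q = (1/2::real) *\<^sub>R x + (1/2::real) *\<^sub>R y"
    have "\<phi> ((1 - 1/2) *\<^sub>R x + (1/2) *\<^sub>R y) \<le> ereal (1 - 1/2) * \<phi> x + ereal (1/2) * \<phi> y"
      using conv[unfolded convex_fun_def, rule_format, of "1/2" x y] by simp
    then have *: "\<phi> q \<le> ereal (r x / 2 + r y / 2)"
      by (simp add: q_def r[OF that(1)] r[OF that(2)])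
    then have "q \<in> D" by (auto simp: D_def)
    with * have "r q \<le> r x / 2 + r y / 2" by (simp add: r)
    then have "c * r q \<le> c * (r x / 2 + r y / 2)" using c by simp
    moreover have "m \<le> J q" using \<open>q \<in> D\<close> by (rule m_le)
    ultimately show ?thesis
      unfolding J_def q_def parallelogram_midpoint by (simp add: algebra_simps)
  qed
  have "Cauchy X"
  proof (rule metric_CauchyI)
    fix e :: real assume e: "0 < e"
    obtain N where "8 / e\<^sup>2 < real N"
      using reals_Archimedean2 by blast
    then have N: "8 / e\<^sup>2 < real (Suc N)" by simp
    have "dist (X i) (X j) < e" if "N \<le> i" "N \<le> j" for i j
    proof -
      have 1: "1 / real (Suc k) \<le> 1 / real (Suc N)" if "N \<le> k" for k
        using that by (simp add: frac_le)
      have "(norm (X i - X j))\<^sup>2 \<le> 4 * (J (X i) - m) + 4 * (J (X j) - m)"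
        by (intro gap XD)
      also have "\<dots> \<le> 4 * (1 / real (Suc N)) + 4 * (1 / real (Suc N))"
        using XJ[of i] XJ[of j] 1[OF that(1)] 1[OF that(2)]
        by (intro add_mono mult_left_mono) auto
      also have "\<dots> = 8 / real (Suc N)" by simp
      also have "\<dots> < e\<^sup>2" using N e by (simp add: field_simps)
      finally show ?thesis using e by (simp add: dist_norm power2_less_imp_less)
    qed
    then show "\<exists>M. \<forall>m\<ge>M. \<forall>n\<ge>M. dist (X m) (X n) < e" by blast
  qed
  then obtain p where p: "X \<longlonglongrightarrow> p" using Cauchy_convergent convergent_def by blast
  \<comment> \<open>\<open>\<phi> p \<le> K\<close> is the assertion \<open>J p \<le> m\<close> solved for \<open>\<phi> p\<close>, which makes sense before \<open>\<phi> p\<close> is known to be finite\<close>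
  define K where "K = (m - 1 / 2 * (norm (p - z))\<^sup>2) / c"
  have lim: "(\<lambda>n. (m + 1 / real (Suc n) - 1 / 2 * (norm (X n - z))\<^sup>2) / c) \<longlonglongrightarrow> K"
  proof -
    have inv: "(\<lambda>n. 1 / real (Suc n)) \<longlonglongrightarrow> 0"
      using LIMSEQ_inverse_real_of_nat by (simp add: inverse_eq_divide)
    have "(\<lambda>n. (m + 1 / real (Suc n) - 1 / 2 * (norm (X n - z))\<^sup>2) / c)
        \<longlonglongrightarrow> (m + 0 - 1 / 2 * (norm (p - z))\<^sup>2) / c"
      using c by (intro tendsto_intros p inv) auto
    then show ?thesis by (simp add: K_def)
  qed
  have "\<phi> p \<le> ereal K"
  proof (rule ccontr)
    assume "\<not> \<phi> p \<le> ereal K"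
    then obtain t where t: "K < t" "ereal t < \<phi> p"
      using ereal_dense2[of "ereal K" "\<phi> p"] by (auto simp: not_le)
    have "\<forall>\<^sub>F y in nhds p. ereal t < \<phi> y" using lsc t(2) by (auto simp: lsc_fun_def)
    then have "\<forall>\<^sub>F n in sequentially. ereal t < \<phi> (X n)"
      using p by (rule eventually_compose_filterlim)
    moreover have "\<forall>\<^sub>F n in sequentially. (m + 1 / real (Suc n) - 1 / 2 * (norm (X n - z))\<^sup>2) / c < t"
      using lim t(1) by (rule order_tendstoD)
    ultimately have "\<forall>\<^sub>F n in sequentially. False"
    proof eventually_elim
      case (elim n)
      have "t < r (X n)" using elim(1) r[OF XD] by simp
      moreover have "r (X n) < (m + 1 / real (Suc n) - 1 / 2 * (norm (X n - z))\<^sup>2) / c"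
        using XJ[of n] unfolding J_def pos_less_divide_eq[OF c] by (simp add: mult.commute)
      ultimately show False using elim(2) by simp
    qed
    then show False by simp
  qed
  then have "p \<in> D" by (auto simp: D_def)
  with \<open>\<phi> p \<le> ereal K\<close> have "r p \<le> K" by (simp add: r)
  then have Jp: "J p \<le> m" using c unfolding J_def K_def by (simp add: field_simps)
  show ?thesis
  proof (intro exI allI)
    fix x
    show "ereal c * \<phi> p + ereal (1 / 2 * (norm (p - z))\<^sup>2)
        \<le> ereal c * \<phi> x + ereal (1 / 2 * (norm (x - z))\<^sup>2)"
    proof (cases "x \<in> D")
      case True
      then have "J p \<le> J x" using Jp m_le[of x] by linarith
      then show ?thesis using True \<open>p \<in> D\<close> by (simp add: r J_def)
    next
      case False
      then show ?thesis using c by (simp add: D_def)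
    qed
  qed
qed

definition subgradient :: "('a::real_inner \<Rightarrow> ereal) \<Rightarrow> 'a \<Rightarrow> 'a \<Rightarrow> bool" where
  "subgradient \<phi> p u \<longleftrightarrow> (\<forall>x. \<phi> p + ereal (u \<bullet> (x - p)) \<le> \<phi> x)"

text \<open>
  Fermat's rule for the proximal objective: compare the minimizer \<open>p\<close> with \<open>p + t (x - p)\<close>, divide by
  \<open>t\<close>, and let \<open>t\<close> tend to 0, which removes the quadratic term.
\<close>

lemma prox_subgradient:
  fixes \<phi> :: "'a::{real_inner,complete_space} \<Rightarrow> ereal"
  assumes \<phi>: "proper_lsc_convex \<phi>" and c: "0 < c"
  shows "\<bar>\<phi> (prox c \<phi> z)\<bar> \<noteq> \<infinity>"
    and "subgradient \<phi> (prox c \<phi> z) ((1 / c) *\<^sub>R (z - prox c \<phi> z))"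
proof -
  have proper: "\<And>x. \<phi> x \<noteq> -\<infinity>" and conv: "convex_fun \<phi>"
    using \<phi> by (auto simp: proper_lsc_convex_def proper_fun_def)
  define p where "p = prox c \<phi> z"
  define \<Phi> where "\<Phi> x = ereal c * \<phi> x + ereal (1 / 2 * (norm (x - z))\<^sup>2)" for x
  have "\<exists>p. is_arg_min \<Phi> (\<lambda>_. True) p"
    using prox_objective_has_minimizer[OF \<phi> c, of z]
    unfolding is_arg_min_def \<Phi>_def by (auto simp: not_less)
  then have "is_arg_min \<Phi> (\<lambda>_. True) p"
    unfolding p_def prox_def arg_min_def \<Phi>_def by (rule someI_ex)
  then have min: "\<Phi> p \<le> \<Phi> x" for x by (auto simp: is_arg_min_def not_less)
  obtain x0 where x0: "\<phi> x0 \<noteq> \<infinity>"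
    using \<phi> by (auto simp: proper_lsc_convex_def proper_fun_def)
  have fin: "\<phi> p \<noteq> \<infinity>"
  proof
    assume "\<phi> p = \<infinity>"
    then have "\<Phi> p = \<infinity>" using c by (simp add: \<Phi>_def)
    moreover have "\<Phi> x0 < \<infinity>" using x0 proper[of x0] by (cases "\<phi> x0") (auto simp: \<Phi>_def)
    ultimately show False using min[of x0] by simp
  qed
  then obtain v where v: "\<phi> p = ereal v" using proper[of p] by (cases "\<phi> p") auto
  then show "\<bar>\<phi> (prox c \<phi> z)\<bar> \<noteq> \<infinity>" by (simp add: p_def[symmetric])
  have "\<phi> p + ereal (((1 / c) *\<^sub>R (z - p)) \<bullet> (x - p)) \<le> \<phi> x" for x
  proof (cases "\<phi> x")
    case (real u)
    have step: "c * (v - u) \<le> (p - z) \<bullet> (x - p) + t * ((norm (x - p))\<^sup>2 / 2)" if t: "0 < t" "t < 1" for t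
    proof -
      define y where "y = (1 - t) *\<^sub>R p + t *\<^sub>R x"
      have "\<phi> y \<le> ereal (1 - t) * \<phi> p + ereal t * \<phi> x"
        using conv t unfolding convex_fun_def y_def by blast
      then have y: "\<phi> y \<le> ereal ((1 - t) * v + t * u)" by (simp add: v real)
      then obtain q where q: "\<phi> y = ereal q" using proper[of y] by (cases "\<phi> y") auto
      have "q \<le> (1 - t) * v + t * u" using y q by simp
      then have "c * q \<le> c * ((1 - t) * v + t * u)" using c by simp
      moreover have "c * v + 1 / 2 * (norm (p - z))\<^sup>2 \<le> c * q + 1 / 2 * (norm (y - z))\<^sup>2"
        using min[of y] by (simp add: \<Phi>_def v q)
      moreover have "(norm (y - z))\<^sup>2
          = (norm (p - z))\<^sup>2 + 2 * t * ((p - z) \<bullet> (x - p)) + t\<^sup>2 * (norm (x - p))\<^sup>2"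
      proof -
        have "y - z = (p - z) + t *\<^sub>R (x - p)" by (simp add: y_def algebra_simps)
        show ?thesis
          unfolding power2_norm_eq_inner \<open>y - z = (p - z) + t *\<^sub>R (x - p)\<close>
          by (simp add: inner_add_left inner_add_right inner_commute power2_eq_square)
      qed
      ultimately have "t * (c * (v - u)) \<le> t * ((p - z) \<bullet> (x - p) + t * ((norm (x - p))\<^sup>2 / 2))"
        by (simp add: algebra_simps power2_eq_square)
      then show ?thesis using t by simp
    qed
    have "c * (v - u) \<le> (p - z) \<bullet> (x - p)"
    proof (rule tendsto_lowerbound)
      show "((\<lambda>t. (p - z) \<bullet> (x - p) + t * ((norm (x - p))\<^sup>2 / 2)) \<longlongrightarrow> (p - z) \<bullet> (x - p)) (at_right 0)"
        by (auto intro!: tendsto_eq_intros)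
      show "\<forall>\<^sub>F t in at_right 0. c * (v - u) \<le> (p - z) \<bullet> (x - p) + t * ((norm (x - p))\<^sup>2 / 2)"
        using eventually_at_right_real[OF zero_less_one]
        by (rule eventually_mono) (rule step, auto)
    qed simp
    then have "v + ((1 / c) *\<^sub>R (z - p)) \<bullet> (x - p) \<le> u"
      using c by (simp add: field_simps inner_diff_left)
    then show ?thesis by (simp add: v real)
  qed (use proper in auto)
  then show "subgradient \<phi> (prox c \<phi> z) ((1 / c) *\<^sub>R (z - prox c \<phi> z))"
    by (simp add: subgradient_def p_def)
qed

text \<open>
  Adding the subgradient inequalities at the two proximal points makes the function values cancel;
  what remains is firm nonexpansiveness, which is cocoercivity with constant 1.
\<close>

lemma prox_firmly_nonexpansive:
  fixes \<phi> :: "'a::{real_inner,complete_space} \<Rightarrow> ereal"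
  assumes \<phi>: "proper_lsc_convex \<phi>" and c: "0 < c"
  shows "cocoercive 1 (prox c \<phi>)"
  unfolding cocoercive_def
proof (intro allI)
  fix a b
  define p q where "p = prox c \<phi> a" and "q = prox c \<phi> b"
  obtain v w where vw: "\<phi> p = ereal v" "\<phi> q = ereal w"
    using prox_subgradient(1)[OF \<phi> c, of a] prox_subgradient(1)[OF \<phi> c, of b]
    unfolding p_def[symmetric] q_def[symmetric] by (cases "\<phi> p"; cases "\<phi> q") auto
  have "v + ((1 / c) *\<^sub>R (a - p)) \<bullet> (q - p) \<le> w"
    using prox_subgradient(2)[OF \<phi> c, of a] vw
    unfolding subgradient_def p_def[symmetric] by (auto dest: spec[of _ q])
  moreover have "w + ((1 / c) *\<^sub>R (b - q)) \<bullet> (p - q) \<le> v"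
    using prox_subgradient(2)[OF \<phi> c, of b] vw
    unfolding subgradient_def q_def[symmetric] by (auto dest: spec[of _ p])
  ultimately have "(1 / c) * ((a - p) \<bullet> (q - p)) + (1 / c) * ((b - q) \<bullet> (p - q)) \<le> 0" by simp
  then have "(1 / c) * ((a - p) \<bullet> (q - p) + (b - q) \<bullet> (p - q)) \<le> 0"
    by (simp add: distrib_left)
  then have "(a - p) \<bullet> (q - p) + (b - q) \<bullet> (p - q) \<le> 0"
    using c by (simp add: mult_le_0_iff divide_le_0_iff)
  then have "1 * (norm (p - q))\<^sup>2 \<le> (a - b) \<bullet> (p - q)"
    by (simp add: power2_norm_eq_inner inner_diff_left inner_diff_right inner_commute)
  then show "1 * (norm (prox c \<phi> a - prox c \<phi> b))\<^sup>2 \<le> (a - b) \<bullet> (prox c \<phi> a - prox c \<phi> b)"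
    by (simp only: p_def q_def)
qed

text \<open>
  As a supremum of affine functions a conjugate is always lower semicontinuous and convex. The point
  is that it is finite somewhere: the subgradient of \<open>h\<close> at \<open>prox 1 h 0\<close> is a slope at which the
  supremum is attained.
\<close>

lemma conjugate_proper_lsc_convex:
  fixes h :: "'a::{real_inner,complete_space} \<Rightarrow> ereal"
  assumes h: "proper_lsc_convex h"
  shows "proper_lsc_convex (conjugate h)"
  unfolding proper_lsc_convex_def
proof (intro conjI)
  have hp: "\<And>x. h x \<noteq> -\<infinity>"
    using h by (auto simp: proper_lsc_convex_def proper_fun_def)
  obtain x0 where x0: "h x0 \<noteq> \<infinity>"
    using h by (auto simp: proper_lsc_convex_def proper_fun_def)
  have upper: "ereal (s \<bullet> x) - h x \<le> conjugate h s" for s x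
    unfolding conjugate_def by (rule SUP_upper) simp
  have not_minf: "conjugate h s \<noteq> -\<infinity>" for s
    using upper[of s x0] x0 hp[of x0] by (cases "h x0") auto
  show "proper_fun (conjugate h)"
    unfolding proper_fun_def
  proof (intro conjI allI)
    define p where "p = prox 1 h 0"
    obtain v where v: "h p = ereal v"
      using prox_subgradient(1)[OF h, of 1 0] unfolding p_def[symmetric] by (cases "h p") auto
    have sub: "h p + ereal ((- p) \<bullet> (x - p)) \<le> h x" for x
      using prox_subgradient(2)[OF h, of 1 0] by (simp add: subgradient_def p_def)
    have "conjugate h (- p) \<le> ereal ((- p) \<bullet> p - v)"
      unfolding conjugate_def
    proof (rule SUP_least)
      fix x
      show "ereal (- p \<bullet> x) - h x \<le> ereal (- p \<bullet> p - v)"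
        using sub[of x] hp[of x] by (cases "h x") (auto simp: v inner_diff_right)
    qed
    then have "conjugate h (- p) \<noteq> \<infinity>" by auto
    then show "\<exists>x. conjugate h x \<noteq> \<infinity>" ..
  qed (rule not_minf)
  show "lsc_fun (conjugate h)"
    unfolding lsc_fun_def
  proof (intro allI impI)
    fix s c assume "c < conjugate h s"
    then obtain x where x: "c < ereal (s \<bullet> x) - h x"
      unfolding conjugate_def by (auto simp: less_SUP_iff)
    have "((\<lambda>y. ereal (y \<bullet> x) - h x) \<longlongrightarrow> ereal (s \<bullet> x) - h x) (nhds s)"
    proof (cases "h x")
      case (real u)
      have "((\<lambda>y. ereal (y \<bullet> x - u)) \<longlongrightarrow> ereal (s \<bullet> x - u)) (nhds s)"
        unfolding lim_ereal by (intro tendsto_intros) (simp add: filterlim_ident)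
      then show ?thesis by (simp add: real)
    qed (use hp x in auto)
    then have "\<forall>\<^sub>F y in nhds s. c < ereal (y \<bullet> x) - h x"
      using x by (rule order_tendstoD)
    then show "\<forall>\<^sub>F y in nhds s. c < conjugate h y"
      by (rule eventually_mono) (use upper less_le_trans in blast)
  qed
  show "convex_fun (conjugate h)"
    unfolding convex_fun_def
  proof (intro allI impI)
    fix s y and t :: real assume t: "0 < t \<and> t < 1"
    show "conjugate h ((1 - t) *\<^sub>R s + t *\<^sub>R y)
        \<le> ereal (1 - t) * conjugate h s + ereal t * conjugate h y"
      unfolding conjugate_def[of h "(1 - t) *\<^sub>R s + t *\<^sub>R y"]
    proof (rule SUP_least)
      fix x
      show "ereal (((1 - t) *\<^sub>R s + t *\<^sub>R y) \<bullet> x) - h x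
          \<le> ereal (1 - t) * conjugate h s + ereal t * conjugate h y"
      proof (cases "h x")
        case (real u)
        have "ereal (((1 - t) *\<^sub>R s + t *\<^sub>R y) \<bullet> x) - h x
            = ereal (1 - t) * (ereal (s \<bullet> x) - h x) + ereal t * (ereal (y \<bullet> x) - h x)"
          by (simp add: real algebra_simps inner_add_left)
        also have "\<dots> \<le> ereal (1 - t) * conjugate h s + ereal t * conjugate h y"
          using t by (intro add_mono ereal_mult_left_mono upper) auto
        finally show ?thesis .
      qed (use hp in auto)
    qed
  qed
qed

text \<open>
  The representing vector is the minimizer of \<open>(norm x)\<^sup>2 / 2 - F x\<close>, that is, the proximal point of
  \<open>- F\<close> at the origin. For a linear function, the subgradient inequalities in the directions \<open>y\<close> and
  \<open>- y\<close> combine to an equality.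
\<close>

theorem riesz_representation:
  fixes F :: "'a::{real_inner,complete_space} \<Rightarrow> real"
  assumes "bounded_linear F"
  shows "\<exists>p. \<forall>y. F y = p \<bullet> y"
proof -
  interpret F: bounded_linear F by fact
  have "proper_lsc_convex (\<lambda>x. ereal (- F x))"
    unfolding proper_lsc_convex_def proper_fun_def lsc_fun_def convex_fun_def
  proof (intro conjI allI impI)
    fix x c assume "c < ereal (- F x)"
    moreover have "((\<lambda>y. ereal (- F y)) \<longlongrightarrow> ereal (- F x)) (nhds x)"
      unfolding lim_ereal by (intro tendsto_intros F.tendsto) (simp add: filterlim_ident)
    ultimately show "\<forall>\<^sub>F y in nhds x. c < ereal (- F y)" by (auto intro: order_tendstoD simp del: lim_ereal)
  qed (auto simp: F.add F.scaleR)
  note sub = prox_subgradient(2)[OF this, of 1 0]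
  define p where "p = prox 1 (\<lambda>x. ereal (- F x)) 0"
  have le: "F y \<le> p \<bullet> y" for y
    using sub unfolding subgradient_def p_def[symmetric]
    by (auto dest!: spec[of _ "y + p"] simp: F.add)
  show ?thesis
  proof (intro exI allI antisym)
    fix y show "p \<bullet> y \<le> F y" using le[of "- y"] by (simp add: F.neg)
  qed (rule le)
qed

text \<open>
  \<^const>\<open>adjoint\<close> selects some map with the adjoint property; between infinite-dimensional spaces the
  existence of such a map rests on completeness, through the Riesz representation.
\<close>

lemma adjoint_bounded_linear:
  fixes A :: "'x::{real_inner,complete_space} \<Rightarrow> 's::{real_inner,complete_space}"
  assumes A: "bounded_linear A"
  shows "A x \<bullet> s = x \<bullet> adjoint A s" and "bounded_linear (adjoint A)"
proof -
  have "\<exists>p. \<forall>x. A x \<bullet> s = p \<bullet> x" for s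
    using riesz_representation[of "\<lambda>x. A x \<bullet> s"] A
    by (simp add: bounded_linear_inner_left_comp)
  then obtain B where "\<And>x s. A x \<bullet> s = B s \<bullet> x" by metis
  then have "\<exists>B. \<forall>x s. A x \<bullet> s = x \<bullet> B s" by (metis inner_commute)
  then have adj: "\<forall>x s. A x \<bullet> s = x \<bullet> adjoint A s" unfolding adjoint_def by (rule someI_ex)
  then show "A x \<bullet> s = x \<bullet> adjoint A s" by blast
  obtain K where K: "0 \<le> K" "\<And>x. norm (A x) \<le> norm x * K"
    using bounded_linear.nonneg_bounded[OF A] by blast
  have eqI: "u = v" if "\<And>x. x \<bullet> u = x \<bullet> v" for u v :: 'x
    using that[of "u - v"] by (metis inner_diff_right inner_eq_zero_iff right_minus_eq)
  show "bounded_linear (adjoint A)"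
  proof (rule bounded_linear_intro[where K = K])
    fix r s t
    show "adjoint A (s + t) = adjoint A s + adjoint A t"
      by (rule eqI) (simp add: adj[rule_format, symmetric] inner_add_right)
    show "adjoint A (r *\<^sub>R s) = r *\<^sub>R adjoint A s"
      by (rule eqI) (simp add: adj[rule_format, symmetric])
    have "(norm (adjoint A s))\<^sup>2 = A (adjoint A s) \<bullet> s" by (simp add: adj power2_norm_eq_inner)
    also have "\<dots> \<le> norm (A (adjoint A s)) * norm s" by (rule norm_cauchy_schwarz)
    also have "\<dots> \<le> (norm (adjoint A s) * K) * norm s" by (intro mult_right_mono K) auto
    finally show "norm (adjoint A s) \<le> norm s * K"
      using K(1) by (cases "norm (adjoint A s) = 0") (auto simp: power2_eq_square mult_ac)
  qed
qed

section \<open>Weak cluster points of bounded families\<close>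

text \<open>
  Weak limits are taken along arbitrary filters. A nontrivial filter finer than
  \<^const>\<open>sequentially\<close> plays the part of a weakly convergent subsequence.
\<close>

definition weak_limit :: "('i \<Rightarrow> 'a::real_inner) \<Rightarrow> 'a \<Rightarrow> 'i filter \<Rightarrow> bool" where
  "weak_limit X a F \<longleftrightarrow> (\<forall>y. ((\<lambda>k. X k \<bullet> y) \<longlongrightarrow> a \<bullet> y) F)"

lemma weakly_converges_iff_weak_limit: "weakly_converges X a \<longleftrightarrow> weak_limit X a sequentially"
  by (simp add: weakly_converges_def weak_limit_def)

lemma weak_limitD: "weak_limit X a F \<Longrightarrow> ((\<lambda>k. X k \<bullet> y) \<longlongrightarrow> a \<bullet> y) F"
  by (simp add: weak_limit_def)

lemma tendsto_imp_weak_limit: "(X \<longlongrightarrow> a) F \<Longrightarrow> weak_limit X a F"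
  by (auto simp: weak_limit_def intro: tendsto_intros)

lemma weak_limit_const: "weak_limit (\<lambda>_. a) a F"
  by (simp add: weak_limit_def)

lemma weak_limit_add: "weak_limit X a F \<Longrightarrow> weak_limit Y b F \<Longrightarrow> weak_limit (\<lambda>k. X k + Y k) (a + b) F"
  by (auto simp: weak_limit_def inner_add_left intro: tendsto_add)

lemma weak_limit_diff: "weak_limit X a F \<Longrightarrow> weak_limit Y b F \<Longrightarrow> weak_limit (\<lambda>k. X k - Y k) (a - b) F"
  by (auto simp: weak_limit_def inner_diff_left intro: tendsto_diff)

lemma weak_limit_scaleR: "weak_limit X a F \<Longrightarrow> weak_limit (\<lambda>k. c *\<^sub>R X k) (c *\<^sub>R a) F"
  by (auto simp: weak_limit_def intro: tendsto_mult_left)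

lemma weak_limit_adjoint:
  assumes "\<And>x s. B x \<bullet> s = x \<bullet> C s" and "weak_limit X a F"
  shows "weak_limit (\<lambda>k. B (X k)) (B a) F"
  using assms by (simp add: weak_limit_def)

lemma weak_limit_fst:
  fixes X :: "'i \<Rightarrow> 'a::real_inner \<times> 'b::real_inner"
  assumes "weak_limit X a F" shows "weak_limit (\<lambda>k. fst (X k)) (fst a) F"
  unfolding weak_limit_def
proof
  fix y show "((\<lambda>k. fst (X k) \<bullet> y) \<longlongrightarrow> fst a \<bullet> y) F"
    using weak_limitD[OF assms, of "(y, 0)"] by (simp add: inner_prod_def)
qed

lemma weak_limit_snd:
  fixes X :: "'i \<Rightarrow> 'a::real_inner \<times> 'b::real_inner"
  assumes "weak_limit X a F" shows "weak_limit (\<lambda>k. snd (X k)) (snd a) F"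
  unfolding weak_limit_def
proof
  fix y show "((\<lambda>k. snd (X k) \<bullet> y) \<longlongrightarrow> snd a \<bullet> y) F"
    using weak_limitD[OF assms, of "(0, y)"] by (simp add: inner_prod_def)
qed

text \<open>
  Weak and norm convergence may be combined in an inner product if one factor is bounded; a family
  that converges weakly along a filter need not be bounded, so boundedness is a separate hypothesis.
\<close>

lemma bounded_inner_tendsto_zero:
  fixes X e :: "'i \<Rightarrow> 'a::real_inner"
  assumes X: "\<And>k. norm (X k) \<le> C" and e: "(e \<longlongrightarrow> 0) F"
  shows "((\<lambda>k. X k \<bullet> e k) \<longlongrightarrow> 0) F"
proof (rule Lim_null_comparison)
  show "\<forall>\<^sub>F k in F. norm (X k \<bullet> e k) \<le> C * norm (e k)"
  proof (intro always_eventually allI)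
    fix k
    have "norm (X k \<bullet> e k) \<le> norm (X k) * norm (e k)" by (simp add: Cauchy_Schwarz_ineq2)
    also have "\<dots> \<le> C * norm (e k)" by (intro mult_right_mono X) simp
    finally show "norm (X k \<bullet> e k) \<le> C * norm (e k)" .
  qed
  show "((\<lambda>k. C * norm (e k)) \<longlongrightarrow> 0) F"
    using tendsto_mult_right_zero[OF tendsto_norm_zero[OF e]] .
qed

text \<open>
  The functionals \<open>\<lambda>y. X k \<bullet> y\<close> all lie in a product of compact intervals, which is compact by
  Tychonoff's theorem. A cluster point of them is again linear and bounded by the same constant, hence
  is represented by a vector.
\<close>

lemma bounded_imp_weak_cluster_point:
  fixes X :: "'i \<Rightarrow> 'a::{real_inner,complete_space}"
  assumes F: "F \<noteq> bot" and X: "\<And>k. norm (X k) \<le> C"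
  obtains G a where "G \<le> F" "G \<noteq> bot" "weak_limit X a G"
proof -
  have C: "0 \<le> C" using X order_trans norm_ge_zero by blast
  define \<Phi> :: "'i \<Rightarrow> 'a \<Rightarrow> real" where "\<Phi> k = (\<lambda>y. X k \<bullet> y)" for k
  define K :: "('a \<Rightarrow> real) set" where "K = (\<Pi>\<^sub>E y\<in>UNIV. {- (C * norm y)..C * norm y})"
  have "compactin (product_topology (\<lambda>_. euclidean) UNIV) K"
    unfolding K_def compactin_PiE by auto
  then have "compact K" by (simp add: euclidean_product_topology)
  have mem: "\<Phi> k \<in> K" for k
  proof -
    have "\<bar>X k \<bullet> y\<bar> \<le> C * norm y" for y
      using Cauchy_Schwarz_ineq2[of "X k" y] X[of k] mult_right_mono[OF X[of k], of "norm y"] by simp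
    then show ?thesis by (auto simp: K_def \<Phi>_def abs_le_iff minus_le_iff)
  qed
  have "filtermap \<Phi> F \<noteq> bot" using F by (simp add: filtermap_bot_iff)
  moreover have "eventually (\<lambda>u. u \<in> K) (filtermap \<Phi> F)"
    by (simp add: eventually_filtermap mem)
  ultimately obtain c where "c \<in> K" and c: "inf (nhds c) (filtermap \<Phi> F) \<noteq> bot"
    using \<open>compact K\<close> unfolding compact_filter by blast
  define G where "G = inf F (filtercomap \<Phi> (nhds c))"
  have "G \<noteq> bot"
  proof
    assume "G = bot"
    then have "eventually (\<lambda>_. False) G" by simp
    then obtain P Q where P: "eventually P F" and Q: "eventually Q (filtercomap \<Phi> (nhds c))"
      and PQ: "\<And>k. P k \<and> Q k \<Longrightarrow> False"
      unfolding G_def eventually_inf by blast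
    from Q obtain R where R: "eventually R (nhds c)" "\<And>k. R (\<Phi> k) \<Longrightarrow> Q k"
      unfolding eventually_filtercomap by blast
    have "eventually (\<lambda>u. \<not> R u) (filtermap \<Phi> F)"
      unfolding eventually_filtermap using P by (rule eventually_mono) (use PQ R in blast)
    with R(1) have "eventually (\<lambda>_. False) (inf (nhds c) (filtermap \<Phi> F))"
      unfolding eventually_inf by blast
    then show False using c by (simp add: trivial_limit_def)
  qed
  have \<Phi>_lim: "filterlim \<Phi> (nhds c) G"
    unfolding G_def by (rule filterlim_mono[OF filterlim_filtercomap order_refl inf_le2])
  have lim: "((\<lambda>k. X k \<bullet> y) \<longlongrightarrow> c y) G" for y
  proof -
    have "((\<lambda>k. \<Phi> k y) \<longlongrightarrow> c y) G"
    proof (rule topological_tendstoI)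
      fix S assume S: "open S" "c y \<in> S"
      have "open ((\<lambda>u::'a \<Rightarrow> real. u y) -` S)"
        by (rule open_vimage[OF S(1)]) simp
      from topological_tendstoD[OF \<Phi>_lim this] S(2)
      show "\<forall>\<^sub>F k in G. \<Phi> k y \<in> S" by simp
    qed
    then show ?thesis by (simp add: \<Phi>_def)
  qed
  have "bounded_linear c"
  proof (rule bounded_linear_intro[where K = C])
    fix y y' and r :: real
    have "((\<lambda>k. X k \<bullet> y + X k \<bullet> y') \<longlongrightarrow> c y + c y') G" by (intro tendsto_add lim)
    then show "c (y + y') = c y + c y'"
      using lim[of "y + y'"] \<open>G \<noteq> bot\<close> by (auto simp: inner_add_right intro: tendsto_unique)
    have "((\<lambda>k. r * (X k \<bullet> y)) \<longlongrightarrow> r * c y) G" by (intro tendsto_mult_left lim)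
    then show "c (r *\<^sub>R y) = r *\<^sub>R c y"
      using lim[of "r *\<^sub>R y"] \<open>G \<noteq> bot\<close> by (auto intro: tendsto_unique)
    show "norm (c y) \<le> norm y * C"
      using \<open>c \<in> K\<close> by (auto simp: K_def PiE_iff abs_le_iff minus_le_iff mult.commute)
  qed
  then obtain a where "\<And>y. c y = a \<bullet> y" using riesz_representation by blast
  then have "weak_limit X a G" using lim by (simp add: weak_limit_def)
  moreover have "G \<le> F" by (simp add: G_def)
  ultimately show ?thesis using that \<open>G \<noteq> bot\<close> by blast
qed

text \<open>
  If some \<open>X k \<bullet> y\<close> failed to converge to \<open>a \<bullet> y\<close>, then the indices at which it stays away from
  \<open>a \<bullet> y\<close> would form a nontrivial finer filter, along which the weak cluster point could not be \<open>a\<close>.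
\<close>

lemma weak_limit_if_unique_cluster_point:
  fixes X :: "'i \<Rightarrow> 'a::{real_inner,complete_space}"
  assumes X: "\<And>k. norm (X k) \<le> C"
    and unique: "\<And>G b. G \<le> F \<Longrightarrow> G \<noteq> bot \<Longrightarrow> weak_limit X b G \<Longrightarrow> b = a"
  shows "weak_limit X a F"
  unfolding weak_limit_def
proof (intro allI topological_tendstoI, rule ccontr)
  fix y S assume S: "open S" "a \<bullet> y \<in> S" and not: "\<not> (\<forall>\<^sub>F k in F. X k \<bullet> y \<in> S)"
  define F' where "F' = inf F (principal {k. X k \<bullet> y \<notin> S})"
  have "F' \<noteq> bot"
    using not by (simp add: F'_def trivial_limit_def eventually_inf_principal)
  then obtain G b where G: "G \<le> F'" "G \<noteq> bot" "weak_limit X b G"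
    using bounded_imp_weak_cluster_point[of F' X C] X by blast
  then have "b = a" using unique[of G b] by (simp add: F'_def)
  then have "\<forall>\<^sub>F k in G. X k \<bullet> y \<in> S"
    using G(3) S by (auto simp: weak_limit_def dest: topological_tendstoD)
  moreover have "\<forall>\<^sub>F k in G. X k \<bullet> y \<notin> S"
    using G(1) by (rule filter_leD) (simp add: F'_def eventually_inf_principal)
  ultimately have "\<forall>\<^sub>F k in G. False" by eventually_elim simp
  then show False using G(2) by simp
qed

lemma tendsto_if_norm_sq_le:
  fixes X :: "'i \<Rightarrow> 'a::real_normed_vector"
  assumes le: "\<And>k. (norm (X k - a))\<^sup>2 \<le> b k" and b: "(b \<longlongrightarrow> 0) F"
  shows "(X \<longlongrightarrow> a) F"
proof -
  have "((\<lambda>k. (norm (X k - a))\<^sup>2) \<longlongrightarrow> 0) F"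
    by (rule tendsto_sandwich[OF _ _ tendsto_const b]) (simp_all add: le)
  then have "((\<lambda>k. sqrt ((norm (X k - a))\<^sup>2)) \<longlongrightarrow> sqrt 0) F" by (rule tendsto_real_sqrt)
  then show ?thesis by (simp add: tendsto_norm_zero_iff LIM_zero_cancel)
qed

text \<open>
  Write \<open>B (X k) - B x\<close> as \<open>(B (X k) - y) + (y - B x)\<close>. Paired with \<open>X k - x\<close>, the first part vanishes
  because it converges in norm, the second because \<open>X k - x\<close> converges weakly to 0; cocoercivity then
  forces \<open>B (X k)\<close> to converge to \<open>B x\<close> in norm.
\<close>

lemma cocoercive_demiclosed:
  assumes B: "cocoercive b B" and b: "0 < b" and F: "F \<noteq> bot"
    and X: "\<And>k. norm (X k) \<le> C" "weak_limit X x F" and y: "((\<lambda>k. B (X k)) \<longlongrightarrow> y) F"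
  shows "B x = y"
proof -
  have "((\<lambda>k. (X k - x) \<bullet> (B (X k) - y)) \<longlongrightarrow> 0) F"
  proof (rule bounded_inner_tendsto_zero)
    fix k show "norm (X k - x) \<le> C + norm x"
      using norm_triangle_ineq4[of "X k" x] X(1)[of k] by simp
  qed (use y in \<open>simp add: LIM_zero\<close>)
  moreover have "((\<lambda>k. (X k - x) \<bullet> (y - B x)) \<longlongrightarrow> (x - x) \<bullet> (y - B x)) F"
    by (intro weak_limitD weak_limit_diff X weak_limit_const)
  ultimately have "((\<lambda>k. ((X k - x) \<bullet> (B (X k) - y) + (X k - x) \<bullet> (y - B x)) / b) \<longlongrightarrow> 0) F"
    by (intro tendsto_divide_zero tendsto_add_zero) simp_all
  moreover have "(norm (B (X k) - B x))\<^sup>2 \<le> ((X k - x) \<bullet> (B (X k) - y) + (X k - x) \<bullet> (y - B x)) / b" for k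
  proof -
    have "b * (norm (B (X k) - B x))\<^sup>2 \<le> (X k - x) \<bullet> (B (X k) - B x)"
      using B by (simp add: cocoercive_def)
    also have "\<dots> = (X k - x) \<bullet> (B (X k) - y) + (X k - x) \<bullet> (y - B x)"
      by (simp add: inner_add_right[symmetric])
    finally show ?thesis using b by (simp add: field_simps)
  qed
  ultimately have "((\<lambda>k. B (X k)) \<longlongrightarrow> B x) F"
    by (rule tendsto_if_norm_sq_le[rotated])
  then show ?thesis using y F tendsto_unique by blast
qed

text \<open>
  Telescoping the descent over a block of indices bounds the block length times its last, smallest
  \<open>q\<close> by the drop of \<open>e\<close> over the block. The block from 0 gives the explicit rate; the block from
  \<open>k div 2\<close> to \<open>k\<close> gives the little-o rate, because the drop of the convergent sequence \<open>e\<close> over it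
  tends to 0.
\<close>

lemma decseq_summable_rate:
  fixes e q :: "nat \<Rightarrow> real"
  assumes c: "0 < c" and e: "\<And>k. 0 \<le> e k" and q: "\<And>k. 0 \<le> q k" "decseq q"
    and descent: "\<And>k. e (Suc k) + c * q k \<le> e k"
  shows "q k \<le> 1 / c * (e 0 / real (k + 1))"
    and "q \<in> o(\<lambda>k. 1 / real (k + 1))"
    and "q \<longlonglongrightarrow> 0"
proof -
  have tail: "real n * (c * q (m + n)) \<le> e m - e (m + n)" for m n
  proof -
    have "c * (\<Sum>i<n. q (m + i)) \<le> e m - e (m + n)"
    proof (induction n)
      case (Suc n)
      then show ?case using descent[of "m + n"] by (simp add: distrib_left)
    qed simp
    moreover have "(\<Sum>i<n. q (m + n)) \<le> (\<Sum>i<n. q (m + i))"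
      using q(2) by (intro sum_mono) (auto intro: decseqD)
    then have "c * (real n * q (m + n)) \<le> c * (\<Sum>i<n. q (m + i))" using c by simp
    ultimately show ?thesis by (simp add: mult_ac)
  qed
  have bound: "q k \<le> 1 / c * (e 0 / real (k + 1))" for k
  proof -
    have "real (k + 1) * (c * q k) \<le> real (k + 1) * (c * q k) + e (Suc k)" using e by simp
    also have "\<dots> \<le> e 0"
      using tail[of k 0] descent[of k] by (simp add: algebra_simps)
    finally have "q k \<le> e 0 / (c * real (k + 1))"
      using c by (subst pos_le_divide_eq) (auto simp: mult_ac)
    then show ?thesis by simp
  qed
  then show "q k \<le> 1 / c * (e 0 / real (k + 1))" .
  have inv: "(\<lambda>k. 1 / real (k + 1)) \<longlonglongrightarrow> 0"
    using LIMSEQ_inverse_real_of_nat by (simp add: inverse_eq_divide)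
  show q0: "q \<longlonglongrightarrow> 0"
  proof (rule tendsto_sandwich[OF _ _ tendsto_const])
    show "(\<lambda>k. 1 / c * (e 0 / real (k + 1))) \<longlonglongrightarrow> 0"
      using tendsto_mult_right_zero[OF inv, of "1 / c * e 0"] by simp
  qed (use q bound in auto)
  have "e (Suc k) \<le> e k" for k
    using descent[of k] mult_nonneg_nonneg[OF less_imp_le[OF c] q(1)[of k]] by linarith
  then have "decseq e" by (rule decseq_SucI)
  moreover have "\<forall>k. 0 \<le> e k" using e by blast
  ultimately obtain l where l: "e \<longlonglongrightarrow> l" by (rule decseq_convergent)
  have half: "filterlim (\<lambda>k::nat. k div 2) at_top at_top"
    by (rule filterlim_at_top_div_const_nat) simp
  have "(\<lambda>k. real (k + 1) * q k) \<longlonglongrightarrow> 0"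
  proof (rule tendsto_sandwich[OF _ _ tendsto_const])
    have "(\<lambda>k. 2 / c * (e (k div 2) - e k) + q k) \<longlonglongrightarrow> 2 / c * (l - l) + 0"
      by (intro tendsto_intros l q0 filterlim_compose[OF l half])
    then show "(\<lambda>k. 2 / c * (e (k div 2) - e k) + q k) \<longlonglongrightarrow> 0" by simp
    show "\<forall>\<^sub>F k in sequentially. real (k + 1) * q k \<le> 2 / c * (e (k div 2) - e k) + q k"
    proof (intro always_eventually allI)
      fix k :: nat
      have "real (k - k div 2) * (c * q k) \<le> e (k div 2) - e k"
        using tail[of "k - k div 2" "k div 2"] by simp
      moreover have "real k / 2 * (c * q k) \<le> real (k - k div 2) * (c * q k)"
        using c q(1)[of k] by (intro mult_right_mono) auto
      ultimately have "real k / 2 * (c * q k) \<le> e (k div 2) - e k" by linarith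
      then have "2 / c * (real k / 2 * (c * q k)) \<le> 2 / c * (e (k div 2) - e k)"
        using c by (intro mult_left_mono) auto
      then show "real (k + 1) * q k \<le> 2 / c * (e (k div 2) - e k) + q k"
        using c by (simp add: distrib_right)
    qed
  qed (use q in auto)
  then show "q \<in> o(\<lambda>k. 1 / real (k + 1))"
    by (intro smalloI_tendsto) (auto simp: mult.commute)
qed

section \<open>The PD3O operator is averaged\<close>

lemma cocoercive_lipschitz:
  assumes G: "cocoercive b G" and b: "0 < b"
  shows "norm (G x - G y) \<le> norm (x - y) / b"
proof (cases "G x = G y")
  case False
  have "b * (norm (G x - G y))\<^sup>2 \<le> (x - y) \<bullet> (G x - G y)" using G by (simp add: cocoercive_def)
  also have "\<dots> \<le> norm (x - y) * norm (G x - G y)" by (rule norm_cauchy_schwarz)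
  finally have "b * norm (G x - G y) \<le> norm (x - y)"
    using False by (simp add: power2_eq_square)
  then show ?thesis using b by (simp add: field_simps)
qed (use b in simp)

text \<open>
  The PD3O operator with arbitrary maps in place of the proximal maps (\<open>P\<close>, \<open>Q\<close>) and of the gradients
  (\<open>B\<close>, \<open>D\<close>). The convergence analysis is about such maps: it uses \<open>P\<close> and \<open>Q\<close> only through firm
  nonexpansiveness, and \<open>B\<close> and \<open>D\<close> only through cocoercivity.
\<close>

definition pd3o_step ::
  "real \<Rightarrow> real \<Rightarrow> ('x::real_inner \<Rightarrow> 's::real_inner) \<Rightarrow> ('x \<Rightarrow> 'x) \<Rightarrow> ('s \<Rightarrow> 's) \<Rightarrow>
   ('x \<Rightarrow> 'x) \<Rightarrow> ('s \<Rightarrow> 's) \<Rightarrow> 'x \<times> 's \<Rightarrow> 'x \<times> 's" where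
  "pd3o_step \<gamma> \<delta> A P Q B D = (\<lambda>(z, s).
     let x = P z;
         s' = Q (s - (\<gamma> * \<delta>) *\<^sub>R A (adjoint A s) - \<delta> *\<^sub>R D s + \<delta> *\<^sub>R A (2 *\<^sub>R x - z - \<gamma> *\<^sub>R B x))
     in (x - \<gamma> *\<^sub>R B x - \<gamma> *\<^sub>R adjoint A s', s'))"

text \<open>
  The condition on \<open>D\<close> avoids the inverse of \<open>M\<close>: if \<open>u = M v\<close>, then the squared
  \<open>M\<close>-inverse norm of \<open>u\<close> is \<open>v \<bullet> M v\<close>. In this form it covers both a constant \<open>D\<close> with semidefinite \<open>M\<close>
  (take \<open>v = 0\<close>) and a cocoercive \<open>D\<close> with definite \<open>M\<close>.
\<close>

locale pd3o =
  fixes A :: "'x::{real_inner,complete_space} \<Rightarrow> 's::{real_inner,complete_space}"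
    and P B :: "'x \<Rightarrow> 'x" and Q D :: "'s \<Rightarrow> 's" and \<gamma> \<delta> \<beta> :: real
  assumes bounded_linear_A: "bounded_linear A"
    and P: "cocoercive 1 P" and Q: "cocoercive 1 Q"
    and B: "cocoercive \<beta> B"
    and psd: "pos_semidef (M_op \<gamma> \<delta> A)"
    and D: "\<And>s t. \<exists>v. D s - D t = M_op \<gamma> \<delta> A v \<and> \<beta> * (v \<bullet> M_op \<gamma> \<delta> A v) \<le> (s - t) \<bullet> M_op \<gamma> \<delta> A v"
    and \<gamma>: "0 < \<gamma>" and \<delta>: "0 < \<delta>" and \<beta>: "0 < \<beta>"
begin

abbreviation M :: "'s \<Rightarrow> 's" where "M \<equiv> M_op \<gamma> \<delta> A"
abbreviation At :: "'s \<Rightarrow> 'x" where "At \<equiv> adjoint A"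
abbreviation T :: "'x \<times> 's \<Rightarrow> 'x \<times> 's" where "T \<equiv> pd3o_step \<gamma> \<delta> A P Q B D"

text \<open>
  The argument of \<open>Q\<close> in the operator, with \<open>(I - \<gamma> \<delta> A A\<^sup>*) s\<close> written as a multiple of \<open>M s\<close>.
\<close>

definition dual_arg :: "'x \<times> 's \<Rightarrow> 's" where
  "dual_arg w = (\<delta> / \<gamma>) *\<^sub>R M (snd w) - \<delta> *\<^sub>R D (snd w)
     + \<delta> *\<^sub>R A (2 *\<^sub>R P (fst w) - fst w - \<gamma> *\<^sub>R B (P (fst w)))"

sublocale A: bounded_linear A by (rule bounded_linear_A)
sublocale At: bounded_linear At by (rule adjoint_bounded_linear) (rule bounded_linear_A)

lemma adj: "A x \<bullet> s = x \<bullet> At s"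
  by (rule adjoint_bounded_linear) (rule bounded_linear_A)

lemma adj': "s \<bullet> A x = At s \<bullet> x"
  using adj[of x s] by (simp add: inner_commute)

lemma scaled_M: "(\<delta> / \<gamma>) *\<^sub>R M s = s - (\<gamma> * \<delta>) *\<^sub>R A (At s)"
  using \<gamma> \<delta> by (simp add: M_op_def)

lemma snd_T: "snd (T w) = Q (dual_arg w)"
  by (simp add: pd3o_step_def Let_def dual_arg_def scaled_M split: prod.split)

lemma fst_T: "fst (T w) = P (fst w) - \<gamma> *\<^sub>R B (P (fst w)) - \<gamma> *\<^sub>R At (snd (T w))"
  by (simp add: pd3o_step_def Let_def split: prod.split)

lemma bounded_linear_M: "bounded_linear M"
proof -
  have "bounded_linear (\<lambda>s. (\<gamma> / \<delta>) *\<^sub>R (s - (\<gamma> * \<delta>) *\<^sub>R A (At s)))"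
    by (intro bounded_linear_scaleR_right[THEN bounded_linear_compose] bounded_linear_sub
        bounded_linear_ident A.bounded_linear[THEN bounded_linear_compose] At.bounded_linear)
  then show ?thesis by (simp add: M_op_def[abs_def])
qed

sublocale M: bounded_linear M by (rule bounded_linear_M)

lemma M_inner: "s \<bullet> M t = (\<gamma> / \<delta>) * (s \<bullet> t) - \<gamma>\<^sup>2 * (At s \<bullet> At t)"
  using \<delta> by (simp add: M_op_def inner_diff_right adj' power2_eq_square algebra_simps)

lemma M_sym: "s \<bullet> M t = t \<bullet> M s"
  by (simp add: M_inner inner_commute)

lemma M_nonneg: "0 \<le> s \<bullet> M s"
  using psd by (simp add: pos_semidef_def)

text \<open>
  Young's inequality in the \<open>M\<close>-seminorm: the seminorm of \<open>a v - s\<close> is nonnegative. It bounds the cross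
  term for \<open>D\<close> just as \<open>inner_young\<close> below bounds the one for \<open>B\<close>.
\<close>

lemma M_young:
  assumes "0 < a"
  shows "2 * (v \<bullet> M s) \<le> a * (v \<bullet> M v) + (s \<bullet> M s) / a"
proof -
  have "0 \<le> (a *\<^sub>R v - s) \<bullet> M (a *\<^sub>R v - s)" by (rule M_nonneg)
  also have "\<dots> = a * (a * (v \<bullet> M v)) - 2 * a * (v \<bullet> M s) + s \<bullet> M s"
    by (simp add: M.diff M.scaleR inner_diff_left inner_diff_right M_sym[of s v] algebra_simps)
  finally show ?thesis using assms by (simp add: field_simps)
qed

text \<open>
  Young's inequality with \<open>v = M s\<close>, combined with \<open>M \<le> (\<gamma> / \<delta>) I\<close>. Through it, convergence in the
  seminorm yields norm convergence of the images under \<open>M\<close>.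
\<close>

lemma M_norm_bound: "(norm (M s))\<^sup>2 \<le> \<gamma> / \<delta> * (s \<bullet> M s)"
proof -
  have "2 * (M s \<bullet> M s) \<le> \<delta> / \<gamma> * (M s \<bullet> M (M s)) + (s \<bullet> M s) / (\<delta> / \<gamma>)"
    using \<gamma> \<delta> by (intro M_young) simp
  moreover have "\<delta> / \<gamma> * (M s \<bullet> M (M s)) \<le> \<delta> / \<gamma> * (\<gamma> / \<delta> * (M s \<bullet> M s))"
    using \<gamma> \<delta> by (intro mult_left_mono) (auto simp: M_inner)
  then have "\<delta> / \<gamma> * (M s \<bullet> M (M s)) \<le> M s \<bullet> M s"
    using \<gamma> \<delta> by simp
  ultimately show ?thesis by (simp add: power2_norm_eq_inner mult.commute)
qed

lemma norm_IM_sq: "(norm_IM M w)\<^sup>2 = (norm (fst w))\<^sup>2 + snd w \<bullet> M (snd w)"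
  by (simp add: norm_IM_def norm_M_def M_nonneg)

lemma norm_IM_nonneg: "0 \<le> norm_IM M w"
  by (simp add: norm_IM_def norm_M_def M_nonneg)

lemma norm_IM_minus_commute: "norm_IM M (v - w) = norm_IM M (w - v)"
proof -
  have "(norm_IM M (v - w))\<^sup>2 = (norm_IM M (w - v))\<^sup>2"
    by (simp add: norm_IM_sq M.diff norm_minus_commute inner_diff_left inner_diff_right)
  then show ?thesis by (simp add: norm_IM_nonneg)
qed

text \<open>
  The bound on \<open>M v\<close> by \<open>v \<bullet> M v\<close> turns the cocoercivity in the \<open>M\<close>-inverse norm into ordinary
  cocoercivity, so that \<open>cocoercive_demiclosed\<close> applies to \<open>D\<close>.
\<close>

lemma D_cocoercive: "cocoercive (\<beta> * \<delta> / \<gamma>) D"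
  unfolding cocoercive_def
proof (intro allI)
  fix s t
  obtain v where v: "D s - D t = M v" "\<beta> * (v \<bullet> M v) \<le> (s - t) \<bullet> M v" using D by blast
  have "\<beta> * \<delta> / \<gamma> * (norm (M v))\<^sup>2 \<le> \<beta> * \<delta> / \<gamma> * (\<gamma> / \<delta> * (v \<bullet> M v))"
    using \<gamma> \<delta> \<beta> by (intro mult_left_mono M_norm_bound) auto
  also have "\<dots> = \<beta> * (v \<bullet> M v)" using \<gamma> \<delta> by simp
  finally show "\<beta> * \<delta> / \<gamma> * (norm (D s - D t))\<^sup>2 \<le> (s - t) \<bullet> (D s - D t)"
    using v by simp
qed

text \<open>
  \<open>D\<close> sees the difference of its arguments only through the \<open>M\<close>-seminorm; this is what makes
  \<open>T_lipschitz_seminorm\<close> possible although the seminorm may vanish on nonzero vectors.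
\<close>

lemma D_lipschitz_M: "(norm (D s - D t))\<^sup>2 \<le> \<gamma> / (\<delta> * \<beta>\<^sup>2) * ((s - t) \<bullet> M (s - t))"
proof -
  obtain v where v: "D s - D t = M v" "\<beta> * (v \<bullet> M v) \<le> (s - t) \<bullet> M v" using D by blast
  have "2 * (v \<bullet> M (s - t)) \<le> \<beta> * (v \<bullet> M v) + ((s - t) \<bullet> M (s - t)) / \<beta>"
    by (rule M_young[OF \<beta>])
  then have "\<beta> * (v \<bullet> M v) \<le> ((s - t) \<bullet> M (s - t)) / \<beta>"
    using v(2) by (simp add: M_sym[of v "s - t"])
  then have "v \<bullet> M v \<le> ((s - t) \<bullet> M (s - t)) / \<beta>\<^sup>2"
    using \<beta> by (simp add: field_simps power2_eq_square)
  then have "\<gamma> / \<delta> * (v \<bullet> M v) \<le> \<gamma> / \<delta> * (((s - t) \<bullet> M (s - t)) / \<beta>\<^sup>2)"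
    using \<gamma> \<delta> by (intro mult_left_mono) auto
  then show ?thesis using M_norm_bound[of v] v(1) by simp
qed

text \<open>
  The algebraic core. The vectors stand for differences of the quantities computed from two points;
  the hypotheses are the monotonicity of the two proximal maps. With \<open>u = \<gamma> A\<^sup>* s'\<close>, the term that is
  quadratic in \<open>s'\<close> in the dual inequality splits into an \<open>M\<close>-part and \<open>u \<bullet> u\<close>; adding the two
  inequalities then collapses all primal products to the polarization of \<open>2 (z - z') \<bullet> z'\<close> and
  products with \<open>F\<close>.
\<close>

lemma monotone_inclusions_inequality:
  fixes x z z' F :: 'x and s s' v :: 's
  assumes primal: "0 \<le> (z - x) \<bullet> x"
    and dual: "0 \<le> ((\<delta> / \<gamma>) *\<^sub>R M s - \<delta> *\<^sub>R M v + \<delta> *\<^sub>R A (2 *\<^sub>R x - z - \<gamma> *\<^sub>R F) - s') \<bullet> s'"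
    and z': "z' = x - \<gamma> *\<^sub>R F - \<gamma> *\<^sub>R At s'"
  shows "(norm z')\<^sup>2 + s' \<bullet> M s' + ((norm (z - z'))\<^sup>2 + (s - s') \<bullet> M (s - s'))
      + 2 * \<gamma> * (x \<bullet> F) + 2 * \<gamma> * (s \<bullet> M v)
    \<le> (norm z)\<^sup>2 + s \<bullet> M s + 2 * \<gamma> * ((z - z') \<bullet> F) + 2 * \<gamma> * ((s - s') \<bullet> M v)"
proof -
  define u where "u = \<gamma> *\<^sub>R At s'"
  have "0 \<le> \<gamma> / \<delta> * (((\<delta> / \<gamma>) *\<^sub>R M s - \<delta> *\<^sub>R M v + \<delta> *\<^sub>R A (2 *\<^sub>R x - z - \<gamma> *\<^sub>R F) - s') \<bullet> s')"
    using dual \<gamma> \<delta> by simp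
  also have "\<dots> = M s \<bullet> s' - \<gamma> * (M v \<bullet> s') + (2 *\<^sub>R x - z - \<gamma> *\<^sub>R F) \<bullet> u - \<gamma> / \<delta> * (s' \<bullet> s')"
    using \<gamma> \<delta>
    by (simp only: inner_add_left inner_diff_left inner_scaleR_left inner_scaleR_right adj u_def)
      (simp add: field_simps)
  also have "\<gamma> / \<delta> * (s' \<bullet> s') = s' \<bullet> M s' + u \<bullet> u"
    by (simp add: M_inner u_def power2_eq_square)
  finally have dual': "0 \<le> s' \<bullet> M s - \<gamma> * (s' \<bullet> M v) + (2 *\<^sub>R x - z - \<gamma> *\<^sub>R F) \<bullet> u - (s' \<bullet> M s' + u \<bullet> u)"
    by (simp only: inner_commute[of "M _"])
  have u: "u = x - \<gamma> *\<^sub>R F - z'" by (simp add: z' u_def)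
  have "2 * ((2 *\<^sub>R x - z - \<gamma> *\<^sub>R F) \<bullet> u) - 2 * (u \<bullet> u) + 2 * ((z - x) \<bullet> x)
      = (norm z)\<^sup>2 - (norm z')\<^sup>2 - (norm (z - z'))\<^sup>2 - 2 * \<gamma> * (x \<bullet> F) + 2 * \<gamma> * ((z - z') \<bullet> F)"
    unfolding power2_norm_eq_inner u
    by (simp add: inner_add_left inner_add_right inner_diff_left inner_diff_right inner_commute
        algebra_simps)
  moreover have "(s - s') \<bullet> M (s - s') = s \<bullet> M s - 2 * (s' \<bullet> M s) + s' \<bullet> M s'"
    by (simp add: M.diff inner_diff_left inner_diff_right M_sym[of s s'])
  moreover have "\<gamma> * ((s - s') \<bullet> M v) = \<gamma> * (s \<bullet> M v) - \<gamma> * (s' \<bullet> M v)"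
    by (simp add: inner_diff_left right_diff_distrib)
  ultimately show ?thesis using dual' primal unfolding mult.assoc by linarith
qed

lemma T_inequality:
  assumes "D (snd w) - D (snd w') = M v"
  defines "x \<equiv> P (fst w)" and "x' \<equiv> P (fst w')"
  shows "(norm_IM M (T w - T w'))\<^sup>2 + (norm_IM M ((w - w') - (T w - T w')))\<^sup>2
      + 2 * \<gamma> * ((x - x') \<bullet> (B x - B x')) + 2 * \<gamma> * ((snd w - snd w') \<bullet> M v)
    \<le> (norm_IM M (w - w'))\<^sup>2 + 2 * \<gamma> * (fst ((w - w') - (T w - T w')) \<bullet> (B x - B x'))
      + 2 * \<gamma> * (snd ((w - w') - (T w - T w')) \<bullet> M v)"
proof -
  have "(norm (fst (T w - T w')))\<^sup>2 + snd (T w - T w') \<bullet> M (snd (T w - T w'))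
      + ((norm (fst (w - w') - fst (T w - T w')))\<^sup>2
         + (snd (w - w') - snd (T w - T w')) \<bullet> M (snd (w - w') - snd (T w - T w')))
      + 2 * \<gamma> * ((x - x') \<bullet> (B x - B x')) + 2 * \<gamma> * (snd (w - w') \<bullet> M v)
    \<le> (norm (fst (w - w')))\<^sup>2 + snd (w - w') \<bullet> M (snd (w - w'))
      + 2 * \<gamma> * ((fst (w - w') - fst (T w - T w')) \<bullet> (B x - B x'))
      + 2 * \<gamma> * ((snd (w - w') - snd (T w - T w')) \<bullet> M v)"
  proof (rule monotone_inclusions_inequality)
    have "(norm (x - x'))\<^sup>2 \<le> (fst w - fst w') \<bullet> (x - x')"
      using P by (simp add: cocoercive_def x_def x'_def)
    then show "0 \<le> (fst (w - w') - (x - x')) \<bullet> (x - x')"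
      by (simp add: power2_norm_eq_inner inner_diff_left)
    have "(norm (snd (T w - T w')))\<^sup>2 \<le> (dual_arg w - dual_arg w') \<bullet> snd (T w - T w')"
      using Q by (simp add: cocoercive_def snd_T)
    moreover have "dual_arg w - dual_arg w' = (\<delta> / \<gamma>) *\<^sub>R M (snd (w - w')) - \<delta> *\<^sub>R M v
        + \<delta> *\<^sub>R A (2 *\<^sub>R (x - x') - fst (w - w') - \<gamma> *\<^sub>R (B x - B x'))"
      unfolding dual_arg_def x_def[symmetric] x'_def[symmetric] assms(1)[symmetric]
      by (simp add: M.diff A.diff A.add A.scaleR algebra_simps)
    ultimately show "0 \<le> ((\<delta> / \<gamma>) *\<^sub>R M (snd (w - w')) - \<delta> *\<^sub>R M v
        + \<delta> *\<^sub>R A (2 *\<^sub>R (x - x') - fst (w - w') - \<gamma> *\<^sub>R (B x - B x')) - snd (T w - T w'))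
        \<bullet> snd (T w - T w')"
      by (simp add: power2_norm_eq_inner inner_diff_left)
    show "fst (T w - T w') = x - x' - \<gamma> *\<^sub>R (B x - B x') - \<gamma> *\<^sub>R At (snd (T w - T w'))"
      by (simp add: fst_T[of w] fst_T[of w'] x_def x'_def At.diff algebra_simps)
  qed
  then show ?thesis by (simp add: norm_IM_sq)
qed

lemma inner_young:
  fixes y F :: "'a::real_inner"
  assumes "0 < a" shows "2 * (y \<bullet> F) \<le> a * (norm F)\<^sup>2 + (norm y)\<^sup>2 / a"
proof -
  have "0 \<le> (norm (a *\<^sub>R F - y))\<^sup>2" by simp
  also have "\<dots> = a * (a * (norm F)\<^sup>2) - 2 * a * (y \<bullet> F) + (norm y)\<^sup>2"
    unfolding power2_norm_eq_inner by (simp add: inner_diff_left inner_diff_right inner_commute algebra_simps)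
  finally show ?thesis using assms by (simp add: field_simps)
qed

text \<open>
  Cocoercivity supplies \<open>2 \<gamma> \<beta>\<close> times the squared gradient differences, and Young's inequality with
  weight \<open>2 \<beta>\<close> spends exactly this amount on the cross terms. The rest costs the fraction
  \<open>\<gamma> / (2 \<beta>)\<close> of the residual, so that \<open>(2 \<beta> - \<gamma>) / (2 \<beta>)\<close> of it survives.
\<close>

lemma T_averaged:
  "(norm_IM M (T w - T w'))\<^sup>2 + (2 * \<beta> - \<gamma>) / (2 * \<beta>) * (norm_IM M ((w - w') - (T w - T w')))\<^sup>2
    \<le> (norm_IM M (w - w'))\<^sup>2"
proof -
  obtain v where v: "D (snd w) - D (snd w') = M v" "\<beta> * (v \<bullet> M v) \<le> (snd w - snd w') \<bullet> M v"
    using D by blast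
  define F where "F = B (P (fst w)) - B (P (fst w'))"
  define r where "r = (w - w') - (T w - T w')"
  have "\<beta> * (norm F)\<^sup>2 \<le> (P (fst w) - P (fst w')) \<bullet> F"
    using B by (simp add: cocoercive_def F_def)
  moreover have "2 * (fst r \<bullet> F) \<le> 2 * \<beta> * (norm F)\<^sup>2 + (norm (fst r))\<^sup>2 / (2 * \<beta>)"
    using \<beta> by (intro inner_young) simp
  moreover have "2 * (snd r \<bullet> M v) \<le> 2 * \<beta> * (v \<bullet> M v) + (snd r \<bullet> M (snd r)) / (2 * \<beta>)"
    using \<beta> M_young[of "2 * \<beta>" v "snd r"] by (simp add: M_sym[of v "snd r"])
  ultimately have "2 * (fst r \<bullet> F) + 2 * (snd r \<bullet> M v)
      \<le> 2 * ((P (fst w) - P (fst w')) \<bullet> F) + 2 * ((snd w - snd w') \<bullet> M v) + (norm_IM M r)\<^sup>2 / (2 * \<beta>)"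
    using v(2) by (simp add: norm_IM_sq add_divide_distrib)
  then have "\<gamma> * (2 * (fst r \<bullet> F) + 2 * (snd r \<bullet> M v))
      \<le> \<gamma> * (2 * ((P (fst w) - P (fst w')) \<bullet> F) + 2 * ((snd w - snd w') \<bullet> M v) + (norm_IM M r)\<^sup>2 / (2 * \<beta>))"
    using \<gamma> by (intro mult_left_mono) auto
  moreover have "(2 * \<beta> - \<gamma>) / (2 * \<beta>) * (norm_IM M r)\<^sup>2 = (norm_IM M r)\<^sup>2 - \<gamma> * ((norm_IM M r)\<^sup>2 / (2 * \<beta>))"
    using \<beta> by (simp add: field_simps)
  ultimately show ?thesis
    using T_inequality[OF v(1)] unfolding F_def[symmetric] r_def[symmetric]
    by (simp add: algebra_simps)
qed

text \<open>
  The same estimate with Young weight \<open>\<beta>\<close>, which spends only half of what cocoercivity supplies. The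
  other half controls the differences of the gradients.
\<close>

lemma gradient_gap:
  "\<gamma> * \<beta> * ((norm (B (P (fst w)) - B (P (fst w'))))\<^sup>2 + \<delta> / \<gamma> * (norm (D (snd w) - D (snd w')))\<^sup>2)
    \<le> (norm_IM M (w - w'))\<^sup>2 - (norm_IM M (T w - T w'))\<^sup>2
      + \<gamma> / \<beta> * (norm_IM M ((w - w') - (T w - T w')))\<^sup>2"
proof -
  obtain v where v: "D (snd w) - D (snd w') = M v" "\<beta> * (v \<bullet> M v) \<le> (snd w - snd w') \<bullet> M v"
    using D by blast
  define F where "F = B (P (fst w)) - B (P (fst w'))"
  define r where "r = (w - w') - (T w - T w')"
  define N where "N = \<delta> / \<gamma> * (norm (M v))\<^sup>2"
  have "\<beta> * (norm F)\<^sup>2 \<le> (P (fst w) - P (fst w')) \<bullet> F"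
    using B by (simp add: cocoercive_def F_def)
  moreover have "2 * (fst r \<bullet> F) \<le> \<beta> * (norm F)\<^sup>2 + (norm (fst r))\<^sup>2 / \<beta>"
    using \<beta> by (intro inner_young)
  moreover have "2 * (snd r \<bullet> M v) \<le> \<beta> * (v \<bullet> M v) + (snd r \<bullet> M (snd r)) / \<beta>"
    using M_young[OF \<beta>, of v "snd r"] by (simp add: M_sym[of v "snd r"])
  moreover have "N \<le> v \<bullet> M v"
    using M_norm_bound[of v] \<gamma> \<delta> by (simp add: N_def field_simps)
  then have "\<beta> * N \<le> \<beta> * (v \<bullet> M v)"
    using \<beta> by (intro mult_left_mono) auto
  ultimately have "2 * (fst r \<bullet> F) + 2 * (snd r \<bullet> M v) + \<beta> * (norm F)\<^sup>2 + \<beta> * N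
      \<le> 2 * ((P (fst w) - P (fst w')) \<bullet> F) + 2 * ((snd w - snd w') \<bullet> M v) + (norm_IM M r)\<^sup>2 / \<beta>"
    using v(2) by (simp add: norm_IM_sq add_divide_distrib)
  then have "\<gamma> * (2 * (fst r \<bullet> F) + 2 * (snd r \<bullet> M v) + \<beta> * (norm F)\<^sup>2 + \<beta> * N)
      \<le> \<gamma> * (2 * ((P (fst w) - P (fst w')) \<bullet> F) + 2 * ((snd w - snd w') \<bullet> M v) + (norm_IM M r)\<^sup>2 / \<beta>)"
    using \<gamma> by (intro mult_left_mono) auto
  then show ?thesis
    using T_inequality[OF v(1)] unfolding F_def[symmetric] r_def[symmetric] v(1) N_def[symmetric]
    by (simp add: distrib_left mult.assoc) (use zero_le_power2[of "norm_IM M r"] in linarith)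
qed

text \<open>
  An image under \<open>T\<close> depends on the dual variable only through \<open>M s\<close> and \<open>D s\<close>, and both are Lipschitz
  in the seminorm. Thus \<open>T\<close> converts seminorm estimates into norm estimates, and identifies points at
  seminorm distance 0. This makes up for a semidefinite or non-coercive \<open>M\<close> in the weak convergence
  proof.
\<close>

lemma T_lipschitz_seminorm:
  "\<exists>C\<ge>0. \<forall>w w'. norm (T w - T w') \<le> C * norm_IM M (w - w')"
proof -
  obtain K where K: "0 \<le> K" "\<And>x. norm (A x) \<le> norm x * K" using A.nonneg_bounded by blast
  obtain L where L: "0 \<le> L" "\<And>s. norm (At s) \<le> norm s * L" using At.nonneg_bounded by blast
  \<comment> \<open>\<open>c\<close> is the Lipschitz constant of the dual component and \<open>C - c\<close> that of the primal component\<close>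
  define c where "c = \<delta> / \<gamma> * sqrt (\<gamma> / \<delta>) + \<delta> * sqrt (\<gamma> / (\<delta> * \<beta>\<^sup>2)) + \<delta> * ((3 + \<gamma> / \<beta>) * K)"
  define C where "C = c + (1 + \<gamma> / \<beta> + \<gamma> * (c * L))"
  have "0 \<le> c" using \<gamma> \<delta> \<beta> K by (simp add: c_def)
  then have "0 \<le> C" using \<gamma> \<delta> \<beta> L by (simp add: C_def)
  moreover have "norm (T w - T w') \<le> C * norm_IM M (w - w')" for w w'
  proof -
    define n where "n = norm_IM M (w - w')"
    have n: "0 \<le> n" by (simp add: n_def norm_IM_nonneg)
    have nsq: "n\<^sup>2 = (norm (fst w - fst w'))\<^sup>2 + (snd w - snd w') \<bullet> M (snd w - snd w')"
      by (simp add: n_def norm_IM_sq)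
    have z: "norm (fst w - fst w') \<le> n"
      using nsq M_nonneg[of "snd w - snd w'"] n by - (rule power2_le_imp_le, simp_all)
    have Ms: "(snd w - snd w') \<bullet> M (snd w - snd w') \<le> n\<^sup>2" by (simp add: nsq)
    define dx where "dx = P (fst w) - P (fst w')"
    define F where "F = B (P (fst w)) - B (P (fst w'))"
    have x: "norm dx \<le> n"
      using cocoercive_lipschitz[OF P, of "fst w" "fst w'"] z by (simp add: dx_def)
    have F: "norm F \<le> n / \<beta>"
      using cocoercive_lipschitz[OF B \<beta>, of "P (fst w)" "P (fst w')"] divide_right_mono[OF x, of \<beta>] \<beta>
      by (simp add: dx_def F_def)
    have M: "norm (M (snd w - snd w')) \<le> sqrt (\<gamma> / \<delta>) * n"
    proof (rule power2_le_imp_le)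
      have "(norm (M (snd w - snd w')))\<^sup>2 \<le> \<gamma> / \<delta> * n\<^sup>2"
        using M_norm_bound[of "snd w - snd w'"] mult_left_mono[OF Ms, of "\<gamma> / \<delta>"] \<gamma> \<delta> by simp
      then show "(norm (M (snd w - snd w')))\<^sup>2 \<le> (sqrt (\<gamma> / \<delta>) * n)\<^sup>2"
        using \<gamma> \<delta> by (simp add: power_mult_distrib)
    qed (use n \<gamma> \<delta> in auto)
    have Dd: "norm (D (snd w) - D (snd w')) \<le> sqrt (\<gamma> / (\<delta> * \<beta>\<^sup>2)) * n"
    proof (rule power2_le_imp_le)
      have "(norm (D (snd w) - D (snd w')))\<^sup>2 \<le> \<gamma> / (\<delta> * \<beta>\<^sup>2) * n\<^sup>2"
        using D_lipschitz_M[of "snd w" "snd w'"] mult_left_mono[OF Ms, of "\<gamma> / (\<delta> * \<beta>\<^sup>2)"] \<gamma> \<delta> by simp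
      then show "(norm (D (snd w) - D (snd w')))\<^sup>2 \<le> (sqrt (\<gamma> / (\<delta> * \<beta>\<^sup>2)) * n)\<^sup>2"
        using \<gamma> \<delta> by (simp add: power_mult_distrib)
    qed (use n \<gamma> \<delta> in auto)
    have A: "norm (A (2 *\<^sub>R dx - (fst w - fst w') - \<gamma> *\<^sub>R F)) \<le> (3 + \<gamma> / \<beta>) * K * n"
    proof -
      have "norm (2 *\<^sub>R dx - (fst w - fst w') - \<gamma> *\<^sub>R F) \<le> 2 * norm dx + norm (fst w - fst w') + \<gamma> * norm F"
        using norm_triangle_ineq4[of "2 *\<^sub>R dx - (fst w - fst w')" "\<gamma> *\<^sub>R F"]
          norm_triangle_ineq4[of "2 *\<^sub>R dx" "fst w - fst w'"] \<gamma> by simp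
      also have "\<dots> \<le> 2 * n + n + \<gamma> * (n / \<beta>)"
        using x z F \<gamma> by (intro add_mono mult_left_mono) auto
      also have "\<dots> = (3 + \<gamma> / \<beta>) * n" by (simp add: algebra_simps)
      finally have "norm (2 *\<^sub>R dx - (fst w - fst w') - \<gamma> *\<^sub>R F) * K \<le> (3 + \<gamma> / \<beta>) * n * K"
        using K(1) by (rule mult_right_mono)
      then have "norm (2 *\<^sub>R dx - (fst w - fst w') - \<gamma> *\<^sub>R F) * K \<le> (3 + \<gamma> / \<beta>) * K * n"
        by (simp only: mult_ac)
      with K(2) show ?thesis by (rule order_trans)
    qed
    have dual: "dual_arg w - dual_arg w' = (\<delta> / \<gamma>) *\<^sub>R M (snd w - snd w') - \<delta> *\<^sub>R (D (snd w) - D (snd w'))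
        + \<delta> *\<^sub>R A (2 *\<^sub>R dx - (fst w - fst w') - \<gamma> *\<^sub>R F)"
      by (simp add: dual_arg_def dx_def F_def M.diff A.diff A.add A.scaleR algebra_simps)
    have "norm (dual_arg w - dual_arg w') \<le> \<delta> / \<gamma> * norm (M (snd w - snd w')) + \<delta> * norm (D (snd w) - D (snd w'))
        + \<delta> * norm (A (2 *\<^sub>R dx - (fst w - fst w') - \<gamma> *\<^sub>R F))"
      unfolding dual using \<gamma> \<delta>
      by (intro order_trans[OF norm_triangle_ineq] order_trans[OF norm_triangle_ineq4] add_mono) auto
    also have "\<dots> \<le> \<delta> / \<gamma> * (sqrt (\<gamma> / \<delta>) * n) + \<delta> * (sqrt (\<gamma> / (\<delta> * \<beta>\<^sup>2)) * n) + \<delta> * ((3 + \<gamma> / \<beta>) * K * n)"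
      using \<gamma> \<delta> by (intro add_mono mult_left_mono M Dd A) auto
    also have "\<dots> = c * n" by (simp add: c_def algebra_simps)
    finally have s: "norm (snd (T w - T w')) \<le> c * n"
      using cocoercive_lipschitz[OF Q, of "dual_arg w" "dual_arg w'"] by (simp add: snd_T)
    have primal: "fst (T w - T w') = dx - \<gamma> *\<^sub>R F - \<gamma> *\<^sub>R At (snd (T w - T w'))"
      by (simp add: fst_T[of w] fst_T[of w'] dx_def F_def At.diff algebra_simps)
    have "norm (fst (T w - T w')) \<le> norm dx + \<gamma> * norm F + \<gamma> * norm (At (snd (T w - T w')))"
      unfolding primal using norm_triangle_ineq4[of "dx - \<gamma> *\<^sub>R F" "\<gamma> *\<^sub>R At (snd (T w - T w'))"]
        norm_triangle_ineq4[of dx "\<gamma> *\<^sub>R F"] \<gamma> by simp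
    also have "\<dots> \<le> n + \<gamma> * (n / \<beta>) + \<gamma> * (c * n * L)"
    proof (intro add_mono mult_left_mono x F)
      show "norm (At (snd (T w - T w'))) \<le> c * n * L"
        using L(2)[of "snd (T w - T w')"] mult_right_mono[OF s L(1)] by linarith
    qed (use \<gamma> in auto)
    finally have zp: "norm (fst (T w - T w')) \<le> n + \<gamma> * (n / \<beta>) + \<gamma> * (c * n * L)" .
    have "norm (T w - T w') \<le> norm (fst (T w - T w')) + norm (snd (T w - T w'))"
      using norm_Pair_le[of "fst (T w - T w')" "snd (T w - T w')"] unfolding prod.collapse .
    also have "\<dots> \<le> C * n" using zp s by (simp add: C_def algebra_simps)
    finally show ?thesis by (simp add: n_def)
  qed
  ultimately show ?thesis by blast
qed

end

section \<open>Convergence of the iterates\<close>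

locale pd3o_iteration = pd3o A P B Q D \<gamma> \<delta> \<beta>
  for A :: "'x::{real_inner,complete_space} \<Rightarrow> 's::{real_inner,complete_space}"
    and P B Q D \<gamma> \<delta> \<beta> +
  fixes w :: "nat \<Rightarrow> 'x \<times> 's" and p :: "'x \<times> 's"
  assumes \<gamma>_less: "\<gamma> < 2 * \<beta>"
    and iteration: "\<And>k. w (Suc k) = T (w k)"
    and fixed_point: "T p = p"
begin

abbreviation \<rho> :: real where "\<rho> \<equiv> (2 * \<beta> - \<gamma>) / (2 * \<beta>)"

lemma \<rho>_pos: "0 < \<rho>"
  using \<gamma>_less \<beta> by simp

lemma descent:
  assumes "T u = u"
  shows "(norm_IM M (w (Suc k) - u))\<^sup>2 + \<rho> * (norm_IM M (T (w k) - w k))\<^sup>2 \<le> (norm_IM M (w k - u))\<^sup>2"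
  using T_averaged[of "w k" u] norm_IM_minus_commute[of "w k" "T (w k)"]
  by (simp add: assms iteration)

lemma distance_Suc_le:
  assumes "T u = u"
  shows "(norm_IM M (w (Suc k) - u))\<^sup>2 \<le> (norm_IM M (w k - u))\<^sup>2"
  using descent[OF assms, of k] mult_nonneg_nonneg[OF less_imp_le[OF \<rho>_pos] zero_le_power2[of "norm_IM M (T (w k) - w k)"]]
  by linarith

lemma distance_decseq:
  assumes "T u = u"
  shows "decseq (\<lambda>k. norm_IM M (w k - u))"
  by (intro decseq_SucI power2_le_imp_le[OF distance_Suc_le[OF assms] norm_IM_nonneg])

lemma residual_decseq: "decseq (\<lambda>k. norm_IM M (T (w k) - w k))"
proof (intro decseq_SucI, rule power2_le_imp_le)
  fix k
  have "(norm_IM M (T (w (Suc k)) - T (w k)))\<^sup>2 + \<rho> * (norm_IM M ((w (Suc k) - w k) - (T (w (Suc k)) - T (w k))))\<^sup>2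
      \<le> (norm_IM M (w (Suc k) - w k))\<^sup>2"
    by (rule T_averaged)
  moreover have "0 \<le> \<rho> * (norm_IM M ((w (Suc k) - w k) - (T (w (Suc k)) - T (w k))))\<^sup>2"
    using \<rho>_pos by (intro mult_nonneg_nonneg) auto
  ultimately have "(norm_IM M (T (w (Suc k)) - T (w k)))\<^sup>2 \<le> (norm_IM M (w (Suc k) - w k))\<^sup>2"
    by linarith
  then show "(norm_IM M (T (w (Suc k)) - w (Suc k)))\<^sup>2 \<le> (norm_IM M (T (w k) - w k))\<^sup>2"
    by (simp add: iteration)
qed (rule norm_IM_nonneg)

lemma residual_rate:
  shows "(norm_IM M (T (w k) - w k))\<^sup>2 \<le> 1 / \<rho> * ((norm_IM M (w 0 - p))\<^sup>2 / real (k + 1))"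
    and "(\<lambda>k. (norm_IM M (T (w k) - w k))\<^sup>2) \<in> o(\<lambda>k. 1 / real (k + 1))"
    and "(\<lambda>k. (norm_IM M (T (w k) - w k))\<^sup>2) \<longlonglongrightarrow> 0"
proof -
  have "decseq (\<lambda>k. (norm_IM M (T (w k) - w k))\<^sup>2)"
    using residual_decseq unfolding decseq_def by (blast intro: power_mono norm_IM_nonneg)
  note rate = decseq_summable_rate[OF \<rho>_pos _ _ this descent[OF fixed_point]]
  show "(norm_IM M (T (w k) - w k))\<^sup>2 \<le> 1 / \<rho> * ((norm_IM M (w 0 - p))\<^sup>2 / real (k + 1))"
    by (rule rate(1)) simp_all
  show "(\<lambda>k. (norm_IM M (T (w k) - w k))\<^sup>2) \<in> o(\<lambda>k. 1 / real (k + 1))"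
    by (rule rate(2)) simp_all
  show "(\<lambda>k. (norm_IM M (T (w k) - w k))\<^sup>2) \<longlonglongrightarrow> 0"
    by (rule rate(3)) simp_all
qed

lemma residual_tendsto_zero: "(\<lambda>k. norm_IM M (T (w k) - w k)) \<longlonglongrightarrow> 0"
  using tendsto_real_sqrt[OF residual_rate(3)] by (simp add: norm_IM_nonneg)

text \<open>
  As in Opial's argument, this is needed for every fixed point and not only for \<open>p\<close>, because it is
  applied to weak cluster points.
\<close>

lemma distance_sq_convergent:
  assumes "T u = u"
  obtains l where "(\<lambda>k. (norm_IM M (w k - u))\<^sup>2) \<longlonglongrightarrow> l"
proof -
  have "decseq (\<lambda>k. (norm_IM M (w k - u))\<^sup>2)"
    using distance_Suc_le[OF assms] by (rule decseq_SucI)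
  moreover have "\<forall>k. 0 \<le> (norm_IM M (w k - u))\<^sup>2" by simp
  ultimately show thesis using that by (rule decseq_convergent)
qed

text \<open>
  The residual tends to 0 in the seminorm; applying \<open>T\<close> once more turns this into convergence in norm.
\<close>

lemma increments_tendsto_zero: "(\<lambda>k. w (Suc k) - w k) \<longlonglongrightarrow> 0"
proof -
  obtain C where C: "\<forall>v v'. norm (T v - T v') \<le> C * norm_IM M (v - v')"
    using T_lipschitz_seminorm by blast
  have "(\<lambda>k. w (Suc (Suc k)) - w (Suc k)) \<longlonglongrightarrow> 0"
  proof (rule Lim_null_comparison)
    show "\<forall>\<^sub>F k in sequentially. norm (w (Suc (Suc k)) - w (Suc k)) \<le> C * norm_IM M (T (w k) - w k)"
      unfolding iteration by (intro always_eventually allI C[rule_format])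
    show "(\<lambda>k. C * norm_IM M (T (w k) - w k)) \<longlonglongrightarrow> 0"
      by (rule tendsto_mult_right_zero) (rule residual_tendsto_zero)
  qed
  then show ?thesis by (rule LIMSEQ_imp_Suc)
qed

lemma iterates_bounded:  "\<exists>C. \<forall>k. norm (w k) \<le> C"
proof -
  obtain C where C: "0 \<le> C" "\<forall>v v'. norm (T v - T v') \<le> C * norm_IM M (v - v')"
    using T_lipschitz_seminorm by blast
  have "norm (w k) \<le> norm (w 0) + (norm p + C * norm_IM M (w 0 - p))" for k
  proof (cases k)
    case 0
    then show ?thesis using mult_nonneg_nonneg[OF C(1) norm_IM_nonneg[of "w 0 - p"]] by simp
  next
    case (Suc j)
    have "norm (w k) \<le> norm p + norm (T (w j) - T p)"
      using norm_triangle_sub[of "w k" p] by (simp add: Suc iteration fixed_point)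
    also have "norm (T (w j) - T p) \<le> C * norm_IM M (w j - p)" by (rule C(2)[rule_format])
    also have "\<dots> \<le> C * norm_IM M (w 0 - p)"
      using distance_decseq[OF fixed_point] C(1) by (intro mult_left_mono) (auto simp: decseq_def)
    finally show ?thesis using norm_ge_zero[of "w 0"] by linarith
  qed
  then show ?thesis by blast
qed

text \<open>
  The right-hand side of \<open>gradient_gap\<close> tends to 0, since the distances to \<open>p\<close> converge and the residual
  vanishes. Norm convergence of the gradients is what lets the weak limit pass through them.
\<close>

lemma gradients_tendsto:
  shows "(\<lambda>k. B (P (fst (w k)))) \<longlonglongrightarrow> B (P (fst p))"
    and "(\<lambda>k. D (snd (w k))) \<longlonglongrightarrow> D (snd p)"
proof -
  obtain l where l: "(\<lambda>k. (norm_IM M (w k - p))\<^sup>2) \<longlonglongrightarrow> l"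
    by (rule distance_sq_convergent[OF fixed_point])
  define b where "b k = ((norm_IM M (w k - p))\<^sup>2 - (norm_IM M (w (Suc k) - p))\<^sup>2
      + \<gamma> / \<beta> * (norm_IM M (T (w k) - w k))\<^sup>2) / (\<gamma> * \<beta>)" for k
  have "b \<longlonglongrightarrow> (l - l + \<gamma> / \<beta> * 0) / (\<gamma> * \<beta>)"
    unfolding b_def using \<gamma> \<beta>
    by (intro tendsto_intros l LIMSEQ_Suc[OF l] residual_rate(3)) auto
  then have b: "b \<longlonglongrightarrow> 0" by simp
  have gap: "(norm (B (P (fst (w k))) - B (P (fst p))))\<^sup>2
      + \<delta> / \<gamma> * (norm (D (snd (w k)) - D (snd p)))\<^sup>2 \<le> b k" for k
  proof -
    have "\<gamma> * \<beta> * ((norm (B (P (fst (w k))) - B (P (fst p))))\<^sup>2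
        + \<delta> / \<gamma> * (norm (D (snd (w k)) - D (snd p)))\<^sup>2)
      \<le> (norm_IM M (w k - p))\<^sup>2 - (norm_IM M (w (Suc k) - p))\<^sup>2
        + \<gamma> / \<beta> * (norm_IM M (T (w k) - w k))\<^sup>2"
      using gradient_gap[of "w k" p] norm_IM_minus_commute[of "w k" "T (w k)"]
      by (simp add: fixed_point iteration)
    then show ?thesis
      unfolding b_def using \<gamma> \<beta> by (subst pos_le_divide_eq) (auto simp: mult.commute)
  qed
  show "(\<lambda>k. B (P (fst (w k)))) \<longlonglongrightarrow> B (P (fst p))"
  proof (rule tendsto_if_norm_sq_le[OF _ b])
    fix k
    have "0 \<le> \<delta> / \<gamma> * (norm (D (snd (w k)) - D (snd p)))\<^sup>2" using \<gamma> \<delta> by simp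
    then show "(norm (B (P (fst (w k))) - B (P (fst p))))\<^sup>2 \<le> b k"
      using gap[of k] by linarith
  qed
  show "(\<lambda>k. D (snd (w k))) \<longlonglongrightarrow> D (snd p)"
  proof (rule tendsto_if_norm_sq_le[OF _ tendsto_mult_right_zero[OF b]])
    fix k
    have "\<delta> / \<gamma> * (norm (D (snd (w k)) - D (snd p)))\<^sup>2 \<le> b k"
      using gap[of k] zero_le_power2[of "norm (B (P (fst (w k))) - B (P (fst p)))"] by linarith
    then show "(norm (D (snd (w k)) - D (snd p)))\<^sup>2 \<le> \<gamma> / \<delta> * b k"
      using \<gamma> \<delta> by (simp add: field_simps)
  qed
qed

text \<open>
  Firm nonexpansiveness of \<open>J\<close> is monotonicity of the operator whose resolvent is \<open>J\<close>: the inner product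
  pairs the points \<open>J a\<close>, \<open>J b\<close> with the values \<open>a - J a\<close>, \<open>b - J b\<close>.
\<close>

lemma firmly_nonexpansive_monotone:
  assumes "cocoercive 1 J"
  shows "0 \<le> (J a - J b) \<bullet> ((a - J a) - (b - J b))"
proof -
  have "(norm (J a - J b))\<^sup>2 \<le> (J a - J b) \<bullet> (a - b)"
    using assms by (simp add: cocoercive_def inner_commute)
  also have "a - b = ((a - J a) - (b - J b)) + (J a - J b)" by simp
  finally show ?thesis by (simp only: inner_add_right power2_norm_eq_inner)
qed

text \<open>
  Minty's trick. Let \<open>(z, s)\<close> be the weak limit; the equation of the primal update shows that the points
  \<open>X k\<close> converge weakly to \<open>x = z + \<gamma> B (P p\<^sub>1) + \<gamma> A\<^sup>* s\<close>, where \<open>p\<^sub>1\<close> is the primal part of the fixed point.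
  Monotonicity of the two proximal maps is tested against the arguments \<open>z\<close> and \<open>b\<close> that \<open>P\<close> and \<open>Q\<close> have
  to send to \<open>x\<close> and \<open>s\<close>. If they send them to \<open>x'\<close> and \<open>s'\<close>, the sum of the two inequalities, the dual
  one weighted by \<open>\<gamma> / \<delta>\<close>, becomes in the limit
  \<open>(norm (x - x'))\<^sup>2 + \<gamma> / \<delta> * (norm (s - s'))\<^sup>2 \<le> 0\<close>. The weight is chosen so that the products of two
  merely weakly convergent factors, one containing \<open>A\<close> and one its adjoint, cancel.
\<close>

lemma weak_cluster_point_is_fixed:
  assumes G: "G \<le> sequentially" "G \<noteq> bot" and weak: "weak_limit w v G"
  shows "T v = v"
proof -
  define z s x where "z = fst v" and "s = snd v" and "x = z + \<gamma> *\<^sub>R B (P (fst p)) + \<gamma> *\<^sub>R At s"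
  define X where "X k = P (fst (w k))" for k
  define S where "S k = snd (w (Suc k))" for k
  note along = tendsto_mono[OF G(1)]
  have step: "((\<lambda>k. fst (w (Suc k)) - fst (w k)) \<longlongrightarrow> 0) G" "((\<lambda>k. snd (w k) - snd (w (Suc k))) \<longlongrightarrow> 0) G"
    using along[OF tendsto_fst[OF increments_tendsto_zero]]
      tendsto_minus[OF along[OF tendsto_snd[OF increments_tendsto_zero]]] by simp_all
  have BX: "((\<lambda>k. B (X k)) \<longlongrightarrow> B (P (fst p))) G" and DS: "((\<lambda>k. D (snd (w k))) \<longlongrightarrow> D (snd p)) G"
    unfolding X_def by (intro along gradients_tendsto)+
  have wS: "weak_limit (\<lambda>k. w (Suc k)) v G"
    using weak_limit_add[OF weak tendsto_imp_weak_limit[OF along[OF increments_tendsto_zero]]] by simp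
  have S: "weak_limit S s G" unfolding S_def s_def by (rule weak_limit_snd[OF wS])
  have s: "weak_limit (\<lambda>k. snd (w k)) s G" unfolding s_def by (rule weak_limit_snd[OF weak])
  have X_eq: "X k = fst (w (Suc k)) + \<gamma> *\<^sub>R B (X k) + \<gamma> *\<^sub>R At (S k)" for k
    using fst_T[of "w k"] by (simp add: X_def S_def iteration algebra_simps)
  have "weak_limit (\<lambda>k. fst (w (Suc k)) + \<gamma> *\<^sub>R B (X k) + \<gamma> *\<^sub>R At (S k)) x G"
    unfolding x_def z_def
    by (intro weak_limit_add weak_limit_scaleR weak_limit_fst wS tendsto_imp_weak_limit[OF BX]
        weak_limit_adjoint[where C = A, OF _ S]) (simp add: adj')
  then have X: "weak_limit X x G" using X_eq by simp
  obtain C where C: "\<forall>k. norm (w k) \<le> C" using iterates_bounded by blast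
  have Cs: "norm (snd (w k)) \<le> C" for k
    using norm_snd_le[of "snd (w k)" "fst (w k)"] C[rule_format, of k] by simp
  have CX: "norm (X k) \<le> norm (P 0) + C" for k
  proof -
    have "norm (X k) \<le> norm (P 0) + norm (X k - P 0)" using norm_triangle_sub by blast
    also have "norm (X k - P 0) \<le> norm (fst (w k))"
      using cocoercive_lipschitz[OF P, of "fst (w k)" 0] by (simp add: X_def)
    also have "norm (fst (w k)) \<le> C" using norm_fst_le[of "fst (w k)" "snd (w k)"] C[rule_format, of k] by simp
    finally show ?thesis by simp
  qed
  have Bx: "B x = B (P (fst p))" using B \<beta> G(2) CX X BX by (rule cocoercive_demiclosed)
  have Ds: "D s = D (snd p)"
    using D_cocoercive _ G(2) Cs s DS by (rule cocoercive_demiclosed) (use \<beta> \<gamma> \<delta> in simp)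
  define b where "b = s - \<delta> *\<^sub>R D s + \<delta> *\<^sub>R A x"
  define x' s' where "x' = P z" and "s' = Q b"
  \<comment> \<open>\<open>e\<close> and \<open>f\<close> collect the parts of the two inclusions that vanish in norm\<close>
  define e where "e k = (fst (w k) - fst (w (Suc k))) - \<gamma> *\<^sub>R (B (X k) - B x)" for k
  define f where "f k = (\<delta> / \<gamma>) *\<^sub>R M (snd (w k) - S k) - \<delta> *\<^sub>R (D (snd (w k)) - D s)
      + \<delta> *\<^sub>R A (fst (w (Suc k)) - fst (w k))" for k
  have "((\<lambda>k. - (fst (w (Suc k)) - fst (w k)) - \<gamma> *\<^sub>R (B (X k) - B x)) \<longlongrightarrow> - 0 - \<gamma> *\<^sub>R (B x - B x)) G"
    using BX unfolding Bx[symmetric] by (intro tendsto_intros step(1))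
  then have e: "(e \<longlongrightarrow> 0) G" by (simp add: e_def[abs_def])
  have "(f \<longlongrightarrow> (\<delta> / \<gamma>) *\<^sub>R M 0 - \<delta> *\<^sub>R (D s - D s) + \<delta> *\<^sub>R A 0) G"
    using DS step(2) unfolding Ds[symmetric] f_def[abs_def] S_def[symmetric]
    by (intro tendsto_intros M.tendsto A.tendsto step(1))
  then have f: "(f \<longlongrightarrow> 0) G" by (simp add: M.zero A.zero)
  have primal: "0 \<le> (X k - x') \<bullet> (e k - \<gamma> *\<^sub>R At (S k - s) - (x - x'))" for k
  proof -
    have "0 \<le> (X k - x') \<bullet> ((fst (w k) - X k) - (z - x'))"
      unfolding X_def x'_def by (rule firmly_nonexpansive_monotone[OF P])
    also have "(fst (w k) - X k) - (z - x') = e k - \<gamma> *\<^sub>R At (S k - s) - (x - x')"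
    proof -
      have "fst (w k) - X k = fst (w k) - fst (w (Suc k)) - \<gamma> *\<^sub>R B (X k) - \<gamma> *\<^sub>R At (S k)"
        using X_eq[of k] by (simp add: algebra_simps)
      then show ?thesis unfolding e_def Bx by (simp add: x_def At.diff algebra_simps)
    qed
    finally show ?thesis .
  qed
  have dual: "0 \<le> (S k - s') \<bullet> (f k + \<delta> *\<^sub>R A (X k - x) - (s - s'))" for k
  proof -
    have "0 \<le> (S k - s') \<bullet> ((dual_arg (w k) - S k) - (b - s'))"
      using firmly_nonexpansive_monotone[OF Q, of "dual_arg (w k)" b]
      by (simp add: S_def s'_def iteration snd_T)
    also have "(dual_arg (w k) - S k) - (b - s') = f k + \<delta> *\<^sub>R A (X k - x) - (s - s')"
    proof -
      have "2 *\<^sub>R X k - fst (w k) - \<gamma> *\<^sub>R B (X k)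
          = X k + (fst (w (Suc k)) - fst (w k)) + \<gamma> *\<^sub>R At (S k)"
        using X_eq[of k] by (simp add: algebra_simps scaleR_2)
      then have "dual_arg (w k) = (\<delta> / \<gamma>) *\<^sub>R M (snd (w k)) - \<delta> *\<^sub>R D (snd (w k))
          + \<delta> *\<^sub>R (A (X k) + A (fst (w (Suc k)) - fst (w k)) + \<gamma> *\<^sub>R A (At (S k)))"
        unfolding dual_arg_def X_def[symmetric] by (simp only: A.add A.scaleR)
      then have "dual_arg (w k) - S k = (\<delta> / \<gamma>) *\<^sub>R M (snd (w k)) - (\<delta> / \<gamma>) *\<^sub>R M (S k)
          - \<delta> *\<^sub>R D (snd (w k)) + \<delta> *\<^sub>R A (X k) + \<delta> *\<^sub>R A (fst (w (Suc k)) - fst (w k))"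
        unfolding scaled_M[of "S k"] by (simp add: algebra_simps)
      then show ?thesis
        by (simp add: f_def b_def M.diff A.diff scaleR_diff_right)
    qed
    finally show ?thesis .
  qed
  \<comment> \<open>the last summand is what remains of the coupling terms; it is linear in the weakly null \<open>X k - x\<close> and \<open>S k - s\<close>\<close>
  define r where "r k = (X k - x') \<bullet> e k + \<gamma> / \<delta> * ((S k - s') \<bullet> f k)
      - (X k - x') \<bullet> (x - x') - \<gamma> / \<delta> * ((S k - s') \<bullet> (s - s'))
      + \<gamma> * ((X k - x) \<bullet> At (s - s') - (S k - s) \<bullet> A (x - x'))" for k
  have "0 \<le> r k" for k
  proof -
    have "0 \<le> (X k - x') \<bullet> (e k - \<gamma> *\<^sub>R At (S k - s) - (x - x'))
        + \<gamma> / \<delta> * ((S k - s') \<bullet> (f k + \<delta> *\<^sub>R A (X k - x) - (s - s')))"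
      using primal[of k] dual[of k] \<gamma> \<delta> by (intro add_nonneg_nonneg mult_nonneg_nonneg) auto
    also have "\<dots> = (X k - x') \<bullet> e k + \<gamma> / \<delta> * ((S k - s') \<bullet> f k)
        - (X k - x') \<bullet> (x - x') - \<gamma> / \<delta> * ((S k - s') \<bullet> (s - s'))
        + \<gamma> * ((S k - s') \<bullet> A (X k - x) - (X k - x') \<bullet> At (S k - s))"
      using \<delta> by (simp only: inner_add_right inner_diff_right inner_scaleR_right) (simp add: field_simps)
    also have "(S k - s') \<bullet> A (X k - x) - (X k - x') \<bullet> At (S k - s)
        = (X k - x) \<bullet> At (s - s') - (S k - s) \<bullet> A (x - x')"
      by (simp add: adj[symmetric] adj'[symmetric] A.diff At.diff inner_diff_left inner_diff_right inner_commute)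
    finally show ?thesis by (simp add: r_def)
  qed
  moreover have "(r \<longlongrightarrow> 0 + \<gamma> / \<delta> * 0 - (x - x') \<bullet> (x - x') - \<gamma> / \<delta> * ((s - s') \<bullet> (s - s'))
      + \<gamma> * ((x - x) \<bullet> At (s - s') - (s - s) \<bullet> A (x - x'))) G"
    unfolding r_def[abs_def]
  proof (intro tendsto_add tendsto_diff tendsto_mult_left)
    show "((\<lambda>k. (X k - x') \<bullet> e k) \<longlongrightarrow> 0) G"
    proof (rule bounded_inner_tendsto_zero[OF _ e])
      show "norm (X k - x') \<le> norm (P 0) + C + norm x'" for k
        using norm_triangle_ineq4[of "X k" x'] CX[of k] by linarith
    qed
    show "((\<lambda>k. (S k - s') \<bullet> f k) \<longlongrightarrow> 0) G"
    proof (rule bounded_inner_tendsto_zero[OF _ f])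
      show "norm (S k - s') \<le> C + norm s'" for k
        using norm_triangle_ineq4[of "S k" s'] Cs[of "Suc k"] unfolding S_def by linarith
    qed
  qed (intro weak_limitD weak_limit_diff weak_limit_const X S)+
  ultimately have "0 \<le> 0 + \<gamma> / \<delta> * 0 - (x - x') \<bullet> (x - x') - \<gamma> / \<delta> * ((s - s') \<bullet> (s - s'))
      + \<gamma> * ((x - x) \<bullet> At (s - s') - (s - s) \<bullet> A (x - x'))"
    using G(2) by (intro tendsto_lowerbound[where f = r]) auto
  then have "(x - x') \<bullet> (x - x') + \<gamma> / \<delta> * ((s - s') \<bullet> (s - s')) \<le> 0" by simp
  moreover have "0 \<le> (x - x') \<bullet> (x - x')" "0 \<le> \<gamma> / \<delta> * ((s - s') \<bullet> (s - s'))"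
    using \<gamma> \<delta> by simp_all
  ultimately have "(x - x') \<bullet> (x - x') = 0" "\<gamma> / \<delta> * ((s - s') \<bullet> (s - s')) = 0" by linarith+
  then have eq: "P z = x" "Q b = s" using \<gamma> \<delta> by (simp_all add: x'_def s'_def)
  have "dual_arg v = b"
  proof -
    have "2 *\<^sub>R x - z - \<gamma> *\<^sub>R B x = x + \<gamma> *\<^sub>R At s"
      unfolding Bx scaleR_2 by (simp add: x_def)
    then show ?thesis
      by (simp add: dual_arg_def b_def z_def[symmetric] s_def[symmetric] eq scaled_M A.add A.scaleR
          algebra_simps)
  qed
  then have 1: "snd (T v) = s" by (simp add: snd_T eq)
  have "fst (T v) = z"
    unfolding fst_T 1 z_def[symmetric] eq Bx by (simp add: x_def)
  then show ?thesis using 1 by (simp add: prod_eq_iff z_def s_def)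
qed

text \<open>
  Opial's argument in the seminorm: the squared distances to two fixed points converge, and their
  difference is affine in \<open>w k\<close>, so both cluster points give the same value of \<open>d\<close> as a functional. Hence
  their seminorm distance is 0, and being fixed by \<open>T\<close>, which identifies such points, they are equal.
\<close>

lemma weak_cluster_point_unique:
  assumes G: "G \<le> sequentially" "G \<noteq> bot" "weak_limit w v G"
    and G': "G' \<le> sequentially" "G' \<noteq> bot" "weak_limit w v' G'"
  shows "v = v'"
proof -
  have fixed: "T v = v" "T v' = v'"
    using weak_cluster_point_is_fixed G G' by blast+
  define d where "d = (fst (v - v'), M (snd (v - v')))"
  obtain l l' where l: "(\<lambda>k. (norm_IM M (w k - v))\<^sup>2) \<longlonglongrightarrow> l" and l': "(\<lambda>k. (norm_IM M (w k - v'))\<^sup>2) \<longlonglongrightarrow> l'"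
    using distance_sq_convergent[OF fixed(1)] distance_sq_convergent[OF fixed(2)] by metis
  have wd: "w k \<bullet> d = ((norm_IM M (w k - v'))\<^sup>2 - (norm_IM M (w k - v))\<^sup>2
      + (norm_IM M v)\<^sup>2 - (norm_IM M v')\<^sup>2) / 2" for k
    unfolding norm_IM_sq power2_norm_eq_inner
    by (simp add: d_def inner_prod_def M.diff inner_diff_left inner_diff_right
        M_sym[of "snd v" "snd (w k)"] M_sym[of "snd v'" "snd (w k)"] inner_commute[of "fst v" "fst (w k)"]
        inner_commute[of "fst v'" "fst (w k)"] field_simps)
  have lim: "(\<lambda>k. w k \<bullet> d) \<longlonglongrightarrow> (l' - l + (norm_IM M v)\<^sup>2 - (norm_IM M v')\<^sup>2) / 2"
    unfolding wd by (intro tendsto_intros l l') simp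
  have "v \<bullet> d = (l' - l + (norm_IM M v)\<^sup>2 - (norm_IM M v')\<^sup>2) / 2"
    using G(2) weak_limitD[OF G(3)] tendsto_mono[OF G(1) lim] by (rule tendsto_unique)
  moreover have "v' \<bullet> d = (l' - l + (norm_IM M v)\<^sup>2 - (norm_IM M v')\<^sup>2) / 2"
    using G'(2) weak_limitD[OF G'(3)] tendsto_mono[OF G'(1) lim] by (rule tendsto_unique)
  ultimately have "(v - v') \<bullet> d = 0" by (simp add: inner_diff_left)
  then have "(norm_IM M (v - v'))\<^sup>2 = 0"
    unfolding norm_IM_sq power2_norm_eq_inner by (simp add: d_def inner_prod_def)
  then have "norm_IM M (v - v') = 0" by simp
  moreover obtain C where "norm (T v - T v') \<le> C * norm_IM M (v - v')"
    using T_lipschitz_seminorm by blast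
  ultimately show ?thesis by (simp add: fixed)
qed

theorem iterates_weakly_converge: "\<exists>v. T v = v \<and> weakly_converges w v"
proof -
  obtain C where "\<forall>k. norm (w k) \<le> C" using iterates_bounded by blast
  then have C: "norm (w k) \<le> C" for k by blast
  obtain G v where G: "G \<le> sequentially" "G \<noteq> bot" "weak_limit w v G"
    by (rule bounded_imp_weak_cluster_point[OF sequentially_bot C])
  have "weak_limit w v sequentially"
    using C weak_cluster_point_unique[OF _ _ _ G] by (rule weak_limit_if_unique_cluster_point)
  moreover have "T v = v" using weak_cluster_point_is_fixed[OF G] .
  ultimately show ?thesis unfolding weakly_converges_iff_weak_limit by blast
qed

end

text \<open>
  Reduces the cocoercivity of the dual gradient, stated with the inverse of \<open>M\<close>, to the inverse-free
  form with a preimage \<open>v\<close>.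
\<close>

lemma cocoercive_MinvE:
  assumes M: "pos_def M" and M0: "M 0 = 0" and G: "cocoercive_Minv \<beta> M G"
  obtains v where "G s - G t = M v" "\<beta> * (v \<bullet> M v) \<le> (s - t) \<bullet> M v"
proof -
  define v where "v = inv M (G s - G t)"
  have range: "G s - G t \<in> range M"
    and le: "\<beta> * (norm_Minv M (G s - G t))\<^sup>2 \<le> (s - t) \<bullet> (G s - G t)"
    using G unfolding cocoercive_Minv_def by auto
  have v: "M v = G s - G t" unfolding v_def using range by (rule f_inv_into_f)
  have "0 \<le> v \<bullet> M v" using M M0 unfolding pos_def_def by (cases "v = 0") (auto intro: less_imp_le)
  moreover have "norm_Minv M (G s - G t) = sqrt (v \<bullet> (G s - G t))"
    by (simp add: norm_Minv_def v_def inner_commute)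
  ultimately have "(norm_Minv M (G s - G t))\<^sup>2 = v \<bullet> M v" by (simp add: v)
  then show thesis using that[of v] le v by simp
qed

theorem theorem1:
  fixes A :: "'x::{real_inner,complete_space} \<Rightarrow> 's::{real_inner,complete_space}"
    and f :: "'x \<Rightarrow> real" and g :: "'x \<Rightarrow> ereal"
    and h l :: "'s \<Rightarrow> ereal"
    and \<gamma> \<delta> \<beta> :: real
    and T :: "'x \<times> 's \<Rightarrow> 'x \<times> 's" and M :: "'s \<Rightarrow> 's"
    and w :: "nat \<Rightarrow> 'x \<times> 's" and wstar :: "'x \<times> 's"
  defines "T \<equiv> T_PD3O \<gamma> \<delta> A f g h l"
    and "M \<equiv> M_op \<gamma> \<delta> A"
  assumes A: "bounded_linear A"
    and f: "proper_lsc_convex (\<lambda>x. ereal (f x))"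
    and g: "proper_lsc_convex g"
    and h: "proper_lsc_convex h"
    and l: "proper_lsc_convex l"
    and f_differentiable: "\<forall>x. f differentiable (at x)"
    and f_Lipschitz: "\<exists>L. L-lipschitz_on UNIV (grad f)"
    and lconj_finite: "\<forall>s. \<bar>conjugate l s\<bar> \<noteq> \<infinity>"
    and lconj_differentiable: "\<forall>s. real_conjugate l differentiable (at s)"
    and lconj_Lipschitz: "\<exists>L. L-lipschitz_on UNIV (grad (real_conjugate l))"
    and stepsizes: "0 < \<gamma>" "0 < \<delta>" "\<gamma> < 2 * \<beta>"
    and beta: "0 < \<beta>"
    and f_cocoercive: "cocoercive \<beta> (grad f)"
    and lconj_cocoercive:
      "(\<forall>s1 s2. grad (real_conjugate l) s1 = grad (real_conjugate l) s2) \<and> pos_semidef M \<or>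
       pos_def M \<and> cocoercive_Minv \<beta> M (grad (real_conjugate l))"
    and fixed_point: "T wstar = wstar"
    and iteration: "\<And>k. w (Suc k) = T (w k)"
  shows "decseq (\<lambda>k. norm_IM M (w k - wstar))
    \<and> (decseq (\<lambda>k. norm_IM M (T (w k) - w k)) \<and> (\<lambda>k. norm_IM M (T (w k) - w k)) \<longlonglongrightarrow> 0)
    \<and> ((\<forall>k. (norm_IM M (T (w k) - w k))\<^sup>2
             \<le> 2 * \<beta> / (2 * \<beta> - \<gamma>) * ((norm_IM M (w 0 - wstar))\<^sup>2 / real (k + 1)))
       \<and> (\<lambda>k. (norm_IM M (T (w k) - w k))\<^sup>2) \<in> o(\<lambda>k. 1 / real (k + 1)))
    \<and> (\<exists>wbar. T wbar = wbar \<and> weakly_converges w wbar)"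
proof -
  define D where "D = grad (real_conjugate l)"
  have T: "T = pd3o_step \<gamma> \<delta> A (prox \<gamma> g) (prox \<delta> (conjugate h)) (grad f) D"
    unfolding T_def T_PD3O_def pd3o_step_def D_def by simp
  have M0: "M 0 = 0"
    using adjoint_bounded_linear(2)[OF A] A
    by (simp add: M_def M_op_def linear_simps(3))
  have "pos_semidef M"
    using lconj_cocoercive M0 unfolding pos_def_def pos_semidef_def
    by (metis inner_zero_left less_eq_real_def order_refl)
  moreover have "\<exists>v. D s - D t = M v \<and> \<beta> * (v \<bullet> M v) \<le> (s - t) \<bullet> M v" for s t
    using lconj_cocoercive unfolding D_def[symmetric]
  proof
    assume "(\<forall>s1 s2. D s1 = D s2) \<and> pos_semidef M"
    then show ?thesis using M0 by (intro exI[of _ 0]) simp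
  next
    assume "pos_def M \<and> cocoercive_Minv \<beta> M D"
    then show ?thesis using M0 by (elim conjE cocoercive_MinvE[of M \<beta> D s t]) auto
  qed
  ultimately interpret pd3o_iteration A "prox \<gamma> g" "grad f" "prox \<delta> (conjugate h)" D \<gamma> \<delta> \<beta> w wstar
    using A prox_firmly_nonexpansive[OF g stepsizes(1)]
      prox_firmly_nonexpansive[OF conjugate_proper_lsc_convex[OF h] stepsizes(2)]
      f_cocoercive stepsizes beta fixed_point iteration
    unfolding T M_def pd3o_iteration_def pd3o_iteration_axioms_def pd3o_def by blast
  have "1 / \<rho> = 2 * \<beta> / (2 * \<beta> - \<gamma>)" by simp
  then show ?thesis
    unfolding T M_def
    using distance_decseq[OF fixed_point[unfolded T]] residual_decseq residual_tendsto_zero residual_rate(1,2)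
      iterates_weakly_converge by simp
qed

end
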